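(* Suppose $n \geq 3$ and $G \subset \mathbb{C}$ satisfies: (i) For all $z \in S^1$, the set $I_z := \{a \in (0,\infty) : az \in G\}$ is an interval containing $1$, but not containing its supremum if $\sup I_z > 1$. (ii) $G$ is closed under the conjugation and modulus maps $z \mapsto \overline{z}$ and $z \mapsto |z|$. (iii) $\widetilde{I} := G \cap \mathbb{R}$ is an interval with $1$ as an interior point, such that $\pm \sup \widetilde{I} \notin \widetilde{I}$. Suppose $K : G \to \mathbb{C}$ is Lebesgue measurable on a sub-interval $I \subset \widetilde{I}$ containing $1$ as an interior point, and either Baire measurable or universally measurable when restricted to the topological group $S^1$. Then the following are equivalent: (1) $K \not\equiv 0$ on $G$, and $K[A] \in \mathbb{P}_n^1(\mathbb{C})$ for all $A \in \mathbb{P}_n^1(G)$. (2) $K(1) > 0$, and $K/K(1) : G \to \mathbb{C}$ is multiplicative and conjugation-equivariant. (3) $K(1) > 0$, and either $K \equiv K(1)$ on $G$ or there exist $\alpha \in \mathbb{R}$ and $\beta \in \mathbb{Z}$ such that $K \equiv K(1) \cdot \Psi_{\alpha,\beta}$ on $G$. Moreover, the maps $\{\Psi_{\alpha,\beta} : \alpha \in \mathbb{R}, \beta \in \mathbb{Z}\} \cup \{K \equiv 1\}$ are linearly independent on $D(0,r)$ for any $0 < r \leq \infty$.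
   Context: $S^1 = \{z \in \mathbb{C} : |z| = 1\}$, and $D(0,r)$ is the complex disc of radius $r$ centered at $0$ (with $D(0,\infty) = \mathbb{C}$). For $S \subset \mathbb{C}$ and integers $1 \leq k \leq n$, $\mathbb{P}_n^k(S)$ denotes the set of $n \times n$ Hermitian positive semidefinite matrices with all entries in $S$ and rank at most $k$. For a matrix $A = (a_{ij})$ with entries in $G$, $K[A] := (K(a_{ij}))$ is obtained by applying $K$ entrywise. For $\alpha \in \mathbb{R}$ and $\beta \in \mathbb{Z}$, the map $\Psi_{\alpha,\beta} : \mathbb{C} \to \mathbb{C}$ is defined by $\Psi_{\alpha,\beta}(re^{i\theta}) := r^\alpha e^{i\beta\theta}$ for $r > 0$, $\theta \in (-\pi,\pi]$, and $\Psi_{\alpha,\beta}(0) := 0$. A function $F : G \to \mathbb{C}$ is multiplicative if $F(zw) = F(z)F(w)$ whenever $z, w, zw \in G$, and conjugation-equivariant if $F(\overline{z}) = \overline{F(z)}$ for all $z \in G$. A function on $S^1$ is Baire measurable if preimages of open sets have the property of Baire (i.e., differ from an open set by a meager set); it is universally measurable if preimages of open sets are measurable with respect to (the completion of) every Borel probability measure on $S^1$. "Lebesgue measurable on $I$" refers to the restriction $K|_I$. The condition $\pm\sup\widetilde I\notin\widetilde I$ means that neither $\sup\widetilde I$ nor $-\sup\widetilde I$ belongs to $\widetilde I$ (automatic if $\sup\widetilde I = \infty$). Linear independence is over $\mathbb{C}$, for functions restricted to $D(0,r)$. *)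

theory Defs
  imports
    "HOL-Probability.Probability_Measure"
    "HOL-Library.Function_Algebras"
begin

text \<open>
  The order on \<^typ>\<open>complex\<close> is the one of \<^theory>\<open>HOL-Library.Complex_Order\<close>:
  \<open>0 \<le> w\<close> (\<open>0 < w\<close>) says that \<open>w\<close> is a nonnegative (positive) real.
\<close>

definition hermitian :: "complex^'n^'n \<Rightarrow> bool" where
  "hermitian A \<longleftrightarrow> (\<forall>i j. A $ i $ j = cnj (A $ j $ i))"

definition pos_semidef :: "complex^'n^'n \<Rightarrow> bool" where
  "pos_semidef A \<longleftrightarrow>
     (\<forall>x :: complex^'n. 0 \<le> (\<Sum>i\<in>UNIV. \<Sum>j\<in>UNIV. cnj (x $ i) * A $ i $ j * x $ j))"

definition PSD_rank_le :: "nat \<Rightarrow> complex set \<Rightarrow> (complex^'n^'n) set" where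
  "PSD_rank_le k S =
     {A. hermitian A \<and> pos_semidef A \<and> (\<forall>i j. A $ i $ j \<in> S) \<and> rank A \<le> k}"

definition map_entries :: "(complex \<Rightarrow> complex) \<Rightarrow> complex^'n^'n \<Rightarrow> complex^'n^'n" where
  "map_entries K A = (\<chi> i j. K (A $ i $ j))"

definition Psi :: "real \<Rightarrow> int \<Rightarrow> complex \<Rightarrow> complex" where
  "Psi \<alpha> \<beta> z =
     (if z = 0 then 0
      else complex_of_real (cmod z powr \<alpha>) * exp (\<i> * of_int \<beta> * complex_of_real (Arg z)))"

definition multiplicative_on :: "complex set \<Rightarrow> (complex \<Rightarrow> complex) \<Rightarrow> bool" where
  "multiplicative_on G F \<longleftrightarrow> (\<forall>z\<in>G. \<forall>w\<in>G. z * w \<in> G \<longrightarrow> F (z * w) = F z * F w)"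

definition conj_equivariant_on :: "complex set \<Rightarrow> (complex \<Rightarrow> complex) \<Rightarrow> bool" where
  "conj_equivariant_on G F \<longleftrightarrow> (\<forall>z\<in>G. F (cnj z) = cnj (F z))"

definition nowhere_dense_in :: "'a topology \<Rightarrow> 'a set \<Rightarrow> bool" where
  "nowhere_dense_in X A \<longleftrightarrow> A \<subseteq> topspace X \<and> X interior_of (X closure_of A) = {}"

definition meager_in :: "'a topology \<Rightarrow> 'a set \<Rightarrow> bool" where
  "meager_in X A \<longleftrightarrow> (\<exists>\<F>. countable \<F> \<and> (\<forall>B\<in>\<F>. nowhere_dense_in X B) \<and> A = \<Union>\<F>)"

definition baire_property_in :: "'a topology \<Rightarrow> 'a set \<Rightarrow> bool" where
  "baire_property_in X A \<longleftrightarrow>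
     A \<subseteq> topspace X \<and> (\<exists>U. openin X U \<and> meager_in X ((A - U) \<union> (U - A)))"

definition baire_measurable_on ::
  "'a::topological_space set \<Rightarrow> ('a \<Rightarrow> 'b::topological_space) \<Rightarrow> bool" where
  "baire_measurable_on S f \<longleftrightarrow> (\<forall>V. open V \<longrightarrow> baire_property_in (top_of_set S) (f -` V \<inter> S))"

definition universally_measurable_on ::
  "'a::topological_space set \<Rightarrow> ('a \<Rightarrow> 'b::topological_space) \<Rightarrow> bool" where
  "universally_measurable_on S f \<longleftrightarrow>
     (\<forall>M. prob_space M \<and> sets M = sets (restrict_space borel S)
        \<longrightarrow> f \<in> borel_measurable (completion M))"

definition radial_slice :: "complex set \<Rightarrow> complex \<Rightarrow> real set" where
  "radial_slice G z = {a. 0 < a \<and> complex_of_real a * z \<in> G}"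

definition real_slice :: "complex set \<Rightarrow> real set" where
  "real_slice G = {x. complex_of_real x \<in> G}"

text \<open>Extended real suprema, so that a set unbounded above has supremum \<open>\<infinity>\<close>, not in the set.\<close>

definition admissible_domain :: "complex set \<Rightarrow> bool" where
  "admissible_domain G \<longleftrightarrow>
     (\<forall>z. cmod z = 1 \<longrightarrow>
        (let J = radial_slice G z; s = Sup (ereal ` J)
         in is_interval J \<and> 1 \<in> J \<and> (1 < s \<longrightarrow> s \<notin> ereal ` J))) \<and>
     (\<forall>z\<in>G. cnj z \<in> G \<and> complex_of_real (cmod z) \<in> G) \<and>
     (let J = real_slice G; s = Sup (ereal ` J)
      in is_interval J \<and> 1 \<in> interior J \<and> s \<notin> ereal ` J \<and> - s \<notin> ereal ` J)"

definition disc :: "ereal \<Rightarrow> complex set" where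
  "disc r = {z. ereal (cmod z) < r}"

global_interpretation cfun: vector_space "\<lambda>(c::complex) (f::complex \<Rightarrow> complex) z. c * f z"
  by unfold_locales (auto simp: algebra_simps)

text \<open>
  The space of functions on \<open>D\<close> is identified with the functions on \<open>\<complex>\<close> vanishing off \<open>D\<close>.
\<close>

definition restrict0 :: "complex set \<Rightarrow> (complex \<Rightarrow> complex) \<Rightarrow> complex \<Rightarrow> complex" where
  "restrict0 D f = (\<lambda>z. if z \<in> D then f z else 0)"

text \<open>
  Injectivity is required because distinct members of \<open>\<F>\<close> with the same restriction to \<open>D\<close> are
  linearly dependent on \<open>D\<close>, but would be identified in the image set.
\<close>

definition lin_independent_on :: "complex set \<Rightarrow> (complex \<Rightarrow> complex) set \<Rightarrow> bool" where
  "lin_independent_on D \<F> \<longleftrightarrow>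
     inj_on (restrict0 D) \<F> \<and> cfun.independent (restrict0 D ` \<F>)"

end

theory Submission
  imports Defs
begin

text \<open>
  A rank-one positive semidefinite matrix is \<open>(u\<^sub>i cnj u\<^sub>j)\<close>, so (1) says that all \<open>2 \<times> 2\<close> minors of
  \<open>(K (u\<^sub>i cnj u\<^sub>j))\<close> vanish; vectors \<open>u\<close> with at most three distinct entries already suffice to
  obtain multiplicativity. On the positive reals \<open>K\<close> first preserves geometric means, which forces
  it to be positive there, and then the polar decomposition reduces everything to the positive
  reals and the circle.

  A multiplicative function on the positive reals near \<open>1\<close>, or on the circle, becomes additive near
  \<open>0\<close> after taking logarithms (arguments). Measurability in either sense gives, by the Steinhaus
  or the Pettis argument, that every small \<open>t\<close> is a difference \<open>x - y\<close> of points with close values,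
  so the additive function is bounded near \<open>0\<close> and hence linear.
\<close>

section \<open>Additive functions and measurability\<close>

text \<open>\<open>G\<close> need not be closed under products, so a test vector is usable only if
  every product \<open>x * cnj y\<close> of its entries lies in \<open>G\<close>, not just the four
  in the minor at hand. This dictates the choice of vectors and the case split at modulus 1. The
  unattained supremum of the real slice leaves room beyond each positive point of \<open>G\<close>,
  so that a single zero of \<open>K\<close> on the positive reals would spread to all of them. The
  constant alternative is exactly the case \<open>K 0 \<noteq> 0\<close>. A vector generating a
  matrix over \<open>G\<close> may have entries outside \<open>G\<close>; hence (1) is recovered
  from the explicit formulas of (3), which make sense on the whole plane, and not directly from (2).
  On the circle the normalised \<open>K\<close> is unimodular, so its values at \<open>w * y\<close>
  and \<open>y\<close> are as far apart as its value at \<open>w\<close> is from 1: one pair of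
  points with quotient \<open>w\<close> suffices.\<close>

lemma locally_additive_bounded_imp_linear:
  fixes g :: "real \<Rightarrow> real"
  assumes d: "0 < d"
    and add: "\<And>s t. \<bar>s\<bar> < d \<Longrightarrow> \<bar>t\<bar> < d \<Longrightarrow> \<bar>s + t\<bar> < d \<Longrightarrow> g (s + t) = g s + g t"
    and bdd: "\<And>t. \<bar>t\<bar> < d \<Longrightarrow> \<bar>g t\<bar> \<le> B"
  shows "\<exists>c. \<forall>t. \<bar>t\<bar> < d \<longrightarrow> g t = c * t"
proof -
  have mult: "g (real k * t) = real k * g t" if "real k * \<bar>t\<bar> < d" "\<bar>t\<bar> < d" for k t
    using that
  proof (induction k)
    case 0
    show ?case using add[of 0 0] d by simp
  next
    case (Suc k)
    have le: "real k * \<bar>t\<bar> < d"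
      using Suc.prems by (simp add: algebra_simps)
    moreover have "\<bar>real k * t + t\<bar> < d"
      using Suc.prems by (simp add: algebra_simps abs_mult flip: distrib_right)
        (metis abs_mult abs_of_nat abs_of_pos of_nat_0_less_iff of_nat_Suc zero_less_Suc add.commute distrib_left mult.commute mult_1)
    ultimately have "g (real k * t + t) = g (real k * t) + g t"
      using add[of "real k * t" t] Suc.prems by (simp add: abs_mult)
    then show ?case
      using Suc le by (simp add: algebra_simps)
  qed
  \<comment> \<open>\<open>d\<close> itself is outside the range of the hypotheses, so the slope is
    read off at an interior point.\<close>
  define a where "a = d / 2"
  have a: "0 < a" "a < d" using d by (auto simp: a_def)
  define c where "c = g a / a"
  have pos: "g t = c * t" if t: "0 \<le> t" "t < d" for t
  proof -
    \<comment> \<open>Divide \<open>t\<close> by the step \<open>a / n\<close>, with quotient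
      \<open>m\<close> and remainder \<open>r\<close>. The quotient gives the slope up to
      \<open>1 / n\<close>; since \<open>n * r\<close> is still below \<open>d\<close>, the bound
      \<open>B\<close> on \<open>g (n * r)\<close> becomes \<open>B / n\<close> on
      \<open>g r\<close>.\<close>
    have est: "\<bar>g t - c * t\<bar> \<le> (\<bar>g a\<bar> + B) / real n" if n: "n > 0" for n :: nat
    proof -
      define h where "h = a / real n"
      have h: "0 < h" "real n * h = a" "h \<le> a" using n a by (auto simp: h_def field_simps)
      define m where "m = nat \<lfloor>t / h\<rfloor>"
      have m: "real m \<le> t / h" "t / h < real m + 1"
        using t h by (simp_all add: m_def)
      define r where "r = t - real m * h"
      have r: "0 \<le> r" "r < h"
        using m h by (auto simp: r_def field_simps)
      have mh: "real m * h \<le> t" using m h by (simp add: field_simps)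
      have nr: "real n * r < d"
        using mult_strict_left_mono[OF r(2), of "real n"] n h(2) a(2) by simp
      have ga: "g a = real n * g h"
        using mult[of n h] h a by simp
      have gmh: "g (real m * h) = real m * g h"
        using mult[of m h] h a mh t by simp
      have "g t = g (real m * h) + g r"
        using add[of "real m * h" r] mh t r h a by (simp add: r_def)
      then have gt: "g t = real m / real n * g a + g r"
        using ga gmh n by simp
      have "real n * \<bar>g r\<bar> \<le> B"
        using mult[of n r] nr r h a bdd[of "real n * r"] by (simp add: abs_mult)
      then have gr: "\<bar>g r\<bar> \<le> B / real n"
        using n by (simp add: field_simps)
      have "t / a - real m / real n = (t / h - real m) / real n"
        using n by (simp add: h_def field_simps)
      moreover have "0 \<le> t / h - real m" "t / h - real m \<le> 1"
        using m by auto
      ultimately have q: "\<bar>t / a - real m / real n\<bar> \<le> 1 / real n"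
        using n by (simp add: divide_right_mono)
      have "g t - c * t = g r - (t / a - real m / real n) * g a"
        using gt a by (simp add: c_def field_simps)
      also have "\<bar>\<dots>\<bar> \<le> \<bar>g r\<bar> + \<bar>t / a - real m / real n\<bar> * \<bar>g a\<bar>"
        by (metis abs_mult abs_triangle_ineq4)
      also have "\<dots> \<le> B / real n + 1 / real n * \<bar>g a\<bar>"
        using gr q by (intro add_mono mult_right_mono) auto
      finally show ?thesis by (simp add: add_divide_distrib add.commute)
    qed
    have "(\<lambda>n. (\<bar>g a\<bar> + B) / real n) \<longlonglongrightarrow> 0"
      by (rule lim_const_over_n)
    then have "\<bar>g t - c * t\<bar> \<le> 0"
      by (rule tendsto_lowerbound) (use est in \<open>auto intro: eventually_sequentiallyI[of 1]\<close>)
    then show ?thesis by simp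
  qed
  have "g t = c * t" if "\<bar>t\<bar> < d" for t
  proof (cases "0 \<le> t")
    case False
    have "g 0 = g t + g (- t)" using add[of t "- t"] that d by simp
    then show ?thesis using pos[of "- t"] pos[of 0] that False d by simp
  qed (use pos that in auto)
  then show ?thesis by blast
qed

section \<open>Small displacements between points with close values\<close>

text \<open>Steinhaus's argument. Countably many balls of radius \<open>e/2\<close> with dense
  centres cover the codomain, so the preimage \<open>A q\<close> of one of them is not null. Values
  on \<open>A q\<close> are within \<open>e\<close> of each other, so it remains to see that
  \<open>A q\<close> meets its small translates.\<close>

lemma measurable_imp_differences_cover:
  fixes f :: "real \<Rightarrow> 'a::{metric_space, second_countable_topology}"
  assumes f: "f \<in> borel_measurable (lebesgue_on {a..b})" and ab: "a < b" and e: "0 < e"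
  shows "\<exists>d>0. \<forall>t. \<bar>t\<bar> < d \<longrightarrow> (\<exists>x\<in>{a..b}. \<exists>y\<in>{a..b}. x - y = t \<and> dist (f x) (f y) < e)"
proof -
  obtain D :: "'a set" where D: "countable D" "\<And>X. open X \<Longrightarrow> X \<noteq> {} \<Longrightarrow> \<exists>d\<in>D. d \<in> X"
    using countable_dense_exists by blast
  define A where "A q = {x\<in>{a..b}. f x \<in> ball q (e/2)}" for q
  have A_sets: "A q \<in> sets lebesgue" for q
  proof -
    have "f -` ball q (e/2) \<inter> space (lebesgue_on {a..b}) \<in> sets (lebesgue_on {a..b})"
      using f by (rule measurable_sets) simp
    moreover have "f -` ball q (e/2) \<inter> space (lebesgue_on {a..b}) = A q"
      by (auto simp: A_def)
    ultimately show ?thesis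
      by (simp add: sets_restrict_space_iff)
  qed
  have "\<exists>q\<in>D. A q \<notin> null_sets lebesgue"
  proof (rule ccontr)
    assume "\<not> ?thesis"
    then have "(\<Union>q\<in>D. A q) \<in> null_sets lebesgue"
      using D(1) by (intro null_sets_UN') auto
    moreover have "(\<Union>q\<in>D. A q) = {a..b}"
    proof -
      have "\<exists>q\<in>D. q \<in> ball (f x) (e/2)" for x
        using D(2)[of "ball (f x) (e/2)"] e by simp
      then show ?thesis by (force simp: A_def dist_commute)
    qed
    ultimately show False
      using ab by (auto simp: null_sets_def)
  qed
  then obtain q where q: "A q \<notin> null_sets lebesgue" by blast
  have A_meas: "A q \<in> lmeasurable"
    by (rule bounded_set_imp_lmeasurable[OF bounded_subset[of "{a..b}"] A_sets]) (auto simp: A_def)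
  define \<mu> where "\<mu> = measure lebesgue (A q)"
  have \<mu>: "\<mu> > 0"
    using q A_meas A_sets unfolding \<mu>_def
    by (metis completion.complete2 emeasure_eq_measure2 ennreal_0 measure_nonneg null_setsI order_le_less)
  \<comment> \<open>A defect of \<open>\<mu>/4\<close> on either side suffices: a translate of the
    compact \<open>C\<close> by less than \<open>d\<close> stays in \<open>U\<close>, and two
    disjoint copies of \<open>C\<close> would have measure above \<open>3/2 * \<mu>\<close>, more
    than the \<open>5/4 * \<mu>\<close> that bounds \<open>U\<close>.\<close>
  obtain C where C: "closed C" "C \<subseteq> A q" "(A q - C) \<in> lmeasurable"
      "emeasure lebesgue (A q - C) < ennreal (\<mu>/4)"
    using sets_lebesgue_inner_closed[OF A_sets, of "\<mu>/4" q] \<mu> by auto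
  obtain U where U: "open U" "A q \<subseteq> U" "(U - A q) \<in> lmeasurable"
      "emeasure lebesgue (U - A q) < ennreal (\<mu>/4)"
    using sets_lebesgue_outer_open[OF A_sets, of "\<mu>/4" q] \<mu> by auto
  have "compact C"
    using C(1,2) bounded_subset[of "{a..b}" C]
    by (metis (no_types, lifting) A_def bounded_closed_interval compact_eq_bounded_closed mem_Collect_eq subset_eq)
  have C_meas: "C \<in> lmeasurable"
    using \<open>compact C\<close> lmeasurable_compact by blast
  have U_eq: "U = A q \<union> (U - A q)" using U by blast
  have U_meas: "U \<in> lmeasurable"
    using U A_meas U_eq fmeasurable.Un by metis
  have "measure lebesgue (A q - C) < \<mu>/4"
    using C(3,4) by (simp add: emeasure_eq_measure2 ennreal_less_iff)
  then have mC: "measure lebesgue C > 3/4 * \<mu>"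
    using measurable_measure_Diff[OF A_meas, of C] C_meas C(2) by (simp add: \<mu>_def)
  have "measure lebesgue (U - A q) < \<mu>/4"
    using U(3,4) by (simp add: emeasure_eq_measure2 ennreal_less_iff)
  then have mU: "measure lebesgue U < 5/4 * \<mu>"
    using measurable_measure_Diff[OF U_meas, of "A q"] A_meas U(2) by (simp add: \<mu>_def)
  obtain d where d: "d > 0" "(\<Union>x\<in>C. ball x d) \<subseteq> U"
    using compact_subset_open_imp_ball_epsilon_subset[OF \<open>compact C\<close> U(1)] C(2) U(2) by auto
  have "\<exists>x\<in>{a..b}. \<exists>y\<in>{a..b}. x - y = t \<and> dist (f x) (f y) < e" if t: "\<bar>t\<bar> < d" for t
  proof -
    have T_meas: "(+) t ` C \<in> lmeasurable"
      using C_meas by (rule measurable_translation)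
    have "(+) t ` C \<subseteq> U"
    proof
      fix x assume "x \<in> (+) t ` C"
      then obtain y where "y \<in> C" "x = t + y" by blast
      with d t show "x \<in> U" by (auto simp: dist_norm intro!: subsetD[OF d(2)] bexI[of _ y])
    qed
    then have "C \<union> (+) t ` C \<subseteq> U" using C(2) U(2) by blast
    then have "measure lebesgue (C \<union> (+) t ` C) \<le> measure lebesgue U"
      using C_meas T_meas U_meas by (intro measure_mono_fmeasurable) auto
    have "C \<inter> (+) t ` C \<noteq> {}"
    proof
      assume "C \<inter> (+) t ` C = {}"
      then have "measure lebesgue (C \<union> (+) t ` C) = measure lebesgue C + measure lebesgue C"
        using C_meas T_meas by (simp add: measure_Un3 measure_translation)
      with \<open>measure lebesgue (C \<union> (+) t ` C) \<le> _\<close> mC mU \<mu> show False by simp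
    qed
    then obtain y where y: "y \<in> C" "t + y \<in> C" by blast
    then have "t + y \<in> A q" "y \<in> A q" using C by auto
    then have "dist (f (t + y)) (f y) < e"
      using dist_triangle_half_r[of q "f (t + y)" e "f y"] by (simp add: A_def)
    then show ?thesis
      using \<open>t + y \<in> A q\<close> \<open>y \<in> A q\<close> by (intro bexI[of _ "t + y"] bexI[of _ y]) (auto simp: A_def)
  qed
  then show ?thesis using d by blast
qed

lemma meager_inE:
  assumes "meager_in X A"
  obtains \<F> where "countable \<F>" "\<forall>B\<in>\<F>. nowhere_dense_in X B" "A = \<Union>\<F>"
  using assms unfolding meager_in_def by (elim exE conjE) (rule that)

text \<open>Pettis's argument, the category version of Steinhaus's: meager sets replace null sets,
  rotations replace translations, and an open \<open>U\<close> equal to \<open>A q\<close> up to a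
  meager set replaces the approximations from inside and outside.\<close>

lemma baire_measurable_circle_imp_quotients_cover:
  fixes F :: "complex \<Rightarrow> 'a::{metric_space, second_countable_topology}"
  assumes F: "baire_measurable_on (sphere 0 1) F" and e: "0 < e"
  shows "\<exists>d>0. \<forall>w. cmod w = 1 \<and> dist w 1 < d \<longrightarrow>
    (\<exists>x\<in>sphere 0 1. \<exists>y\<in>sphere 0 1. x = w * y \<and> dist (F x) (F y) < e)"
proof -
  define X :: "complex topology" where "X = top_of_set (sphere 0 1)"
  have top: "topspace X = sphere 0 1" by (simp add: X_def)
  have comp: "completely_metrizable_space X"
    unfolding X_def
    by (simp add: completely_metrizable_space_closedin completely_metrizable_space_euclidean)
  have Un_meager: "meager_in X (\<Union>\<F>)" if "countable \<F>" "\<And>B. B \<in> \<F> \<Longrightarrow> meager_in X B" for \<F>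
  proof -
    have "\<forall>B\<in>\<F>. \<exists>\<G>. countable \<G> \<and> (\<forall>B\<in>\<G>. nowhere_dense_in X B) \<and> B = \<Union>\<G>"
      using that(2) by (auto simp: meager_in_def)
    from bchoice[OF this] obtain \<G> where
      "\<forall>B\<in>\<F>. countable (\<G> B) \<and> (\<forall>C\<in>\<G> B. nowhere_dense_in X C) \<and> B = \<Union>(\<G> B)" ..
    then have \<G>: "\<And>B. B \<in> \<F> \<Longrightarrow> countable (\<G> B)"
        "\<And>B C. B \<in> \<F> \<Longrightarrow> C \<in> \<G> B \<Longrightarrow> nowhere_dense_in X C"
        "\<And>B. B \<in> \<F> \<Longrightarrow> \<Union>(\<G> B) = B"
      by auto
    have "countable (\<Union>(\<G> ` \<F>))"
      using that(1) \<G>(1) by (intro countable_UN) auto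
    moreover have "\<forall>C\<in>\<Union>(\<G> ` \<F>). nowhere_dense_in X C"
      using \<G>(2) by auto
    moreover have "\<Union>\<F> = \<Union>(\<Union>(\<G> ` \<F>))"
    proof -
      have "\<Union>(\<Union>(\<G> ` \<F>)) = (\<Union>B\<in>\<F>. \<Union>(\<G> B))" by blast
      also have "\<dots> = (\<Union>B\<in>\<F>. B)" using \<G>(3) by (rule SUP_cong[OF refl])
      finally show ?thesis by simp
    qed
    ultimately show ?thesis
      unfolding meager_in_def by (intro exI[of _ "\<Union>(\<G> ` \<F>)"] conjI)
  qed
  have sub_meager: "meager_in X B" if "meager_in X A" "B \<subseteq> A" for A B
  proof -
    obtain \<F> where \<F>: "countable \<F>" "\<forall>B\<in>\<F>. nowhere_dense_in X B" "A = \<Union>\<F>"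
      using \<open>meager_in X A\<close> by (rule meager_inE)
    have "nowhere_dense_in X (C \<inter> B)" if "C \<in> \<F>" for C
      using \<F>(2) that unfolding nowhere_dense_in_def
      by (metis closure_of_mono inf_le1 interior_of_mono le_infI1 subset_empty)
    then show ?thesis
      unfolding meager_in_def using \<F> \<open>B \<subseteq> A\<close>
      by (intro exI[of _ "(\<lambda>C. C \<inter> B) ` \<F>"]) auto
  qed
  \<comment> \<open>Baire's theorem on the circle: the closures of the nowhere dense pieces have
    empty interior, hence so does their countable union, which contains \<open>V\<close>.\<close>
  have not_meager: "\<not> meager_in X V" if "openin X V" "V \<noteq> {}" for V
  proof
    assume "meager_in X V"
    then obtain \<F> where \<F>: "countable \<F>" "\<forall>B\<in>\<F>. nowhere_dense_in X B" "V = \<Union>\<F>"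
      by (rule meager_inE)
    have cl: "\<And>B. B \<in> \<F> \<Longrightarrow> B \<subseteq> X closure_of B"
      using \<F>(2) by (simp add: closure_of_subset nowhere_dense_in_def)
    have "X interior_of (\<Union>((closure_of) X ` \<F>)) = {}"
      using comp \<F> by (intro Baire_category_alt) (auto simp: nowhere_dense_in_def)
    moreover have "V \<subseteq> \<Union>((closure_of) X ` \<F>)"
      using \<F>(3) cl by blast
    then have "V \<subseteq> X interior_of (\<Union>((closure_of) X ` \<F>))"
      using \<open>openin X V\<close> by (simp add: interior_of_maximal)
    ultimately show False using \<open>V \<noteq> {}\<close> by blast
  qed
  have rot: "homeomorphic_map X X ((*) w)" if "cmod w = 1" for w
  proof (rule homeomorphic_maps_imp_map[where g = "\<lambda>x. x / w"])
    have w: "w \<noteq> 0" using that by auto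
    have "continuous_on (sphere 0 1) ((*) w)" "continuous_on (sphere 0 1) (\<lambda>x. x / w)"
      using w by (auto intro!: continuous_intros)
    moreover have "(*) w \<in> sphere 0 1 \<rightarrow> sphere 0 1" "(\<lambda>x. x / w) \<in> sphere 0 1 \<rightarrow> sphere 0 1"
      using that by (simp_all add: Pi_iff norm_mult norm_divide)
    ultimately have "continuous_map X X ((*) w)" "continuous_map X X (\<lambda>x. x / w)"
      by (simp_all add: X_def)
    then show "homeomorphic_maps X X ((*) w) (\<lambda>x. x / w)"
      using w by (simp add: homeomorphic_maps_def)
  qed
  have rot_meager: "meager_in X ((*) w ` A)" if "cmod w = 1" "meager_in X A" for w A
  proof -
    obtain \<F> where \<F>: "countable \<F>" "\<forall>B\<in>\<F>. nowhere_dense_in X B" "A = \<Union>\<F>"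
      using \<open>meager_in X A\<close> by (rule meager_inE)
    have "nowhere_dense_in X ((*) w ` B)" if "B \<in> \<F>" for B
    proof -
      have B: "B \<subseteq> topspace X" "X interior_of (X closure_of B) = {}"
        using \<F> that by (auto simp: nowhere_dense_in_def)
      have "X closure_of ((*) w ` B) = (*) w ` (X closure_of B)"
        using homeomorphic_map_closure_of[OF rot B(1)] \<open>cmod w = 1\<close> by simp
      moreover have "X interior_of ((*) w ` (X closure_of B)) = (*) w ` (X interior_of (X closure_of B))"
        using homeomorphic_map_interior_of[OF rot closure_of_subset_topspace] \<open>cmod w = 1\<close> by simp
      moreover have "(*) w ` B \<subseteq> topspace X"
        using B(1) \<open>cmod w = 1\<close> by (auto simp: top norm_mult)
      ultimately show ?thesis using B by (simp add: nowhere_dense_in_def)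
    qed
    then show ?thesis
      unfolding meager_in_def using \<F>
      by (intro exI[of _ "(`) ((*) w) ` \<F>"]) (auto simp: image_Union)
  qed
  obtain D :: "'a set" where D: "countable D" "\<And>X. open X \<Longrightarrow> X \<noteq> {} \<Longrightarrow> \<exists>d\<in>D. d \<in> X"
    using countable_dense_exists by blast
  define A where "A q = F -` ball q (e/2) \<inter> sphere 0 1" for q
  have "\<exists>q\<in>D. \<not> meager_in X (A q)"
  proof (rule ccontr)
    assume "\<not> ?thesis"
    then have "meager_in X (\<Union>q\<in>D. A q)"
      using D(1) by (intro Un_meager) auto
    moreover have "(\<Union>q\<in>D. A q) = topspace X"
    proof -
      have "\<exists>q\<in>D. q \<in> ball (F x) (e/2)" for x
        using D(2)[of "ball (F x) (e/2)"] e by simp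
      then show ?thesis by (fastforce simp: A_def top dist_commute)
    qed
    moreover have "topspace X \<noteq> {}" by (simp add: top)
    ultimately show False
      using not_meager[OF openin_topspace] by metis
  qed
  then obtain q where q: "\<not> meager_in X (A q)" by blast
  obtain U where U: "openin X U" "meager_in X ((A q - U) \<union> (U - A q))"
    using F by (auto simp: baire_measurable_on_def baire_property_in_def A_def X_def)
  have "U \<noteq> {}" using q U(2) by auto
  then obtain u where u: "u \<in> U" by blast
  obtain T where T: "open T" "U = sphere 0 1 \<inter> T"
    using U(1) by (auto simp: X_def openin_open)
  then obtain d where d: "d > 0" "ball u d \<subseteq> T"
    using u by (auto simp: open_contains_ball)
  have norm_u: "cmod u = 1" using u T by auto
  have "\<exists>x\<in>sphere 0 1. \<exists>y\<in>sphere 0 1. x = w * y \<and> dist (F x) (F y) < e"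
    if w: "cmod w = 1" "dist w 1 < d" for w
  proof -
    have w0: "w \<noteq> 0" using w by auto
    define V where "V = U \<inter> (*) w ` U"
    have "openin X ((*) w ` U)"
      using homeomorphic_map_openness_eq[OF rot[OF w(1)]] U(1) by blast
    then have V: "openin X V" using U by (auto simp: V_def)
    \<comment> \<open>Rotating \<open>u\<close> back moves it by exactly \<open>dist w 1\<close>, so
      \<open>u / w\<close> is still in \<open>U\<close> and \<open>u\<close> is a common point of
      \<open>U\<close> and its rotated copy.\<close>
    have "u / w - u = u * (1 - w) / w" using w0 by (simp add: field_simps)
    then have "dist (u / w) u = dist w 1"
      using w norm_u by (simp add: dist_norm norm_mult norm_divide norm_minus_commute)
    then have "dist u (u / w) < d"
      using w by (simp add: dist_commute)
    then have "u / w \<in> U" using d norm_u w T by (auto simp: norm_divide)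
    then have "u \<in> V" using u w0 by (auto simp: V_def intro!: image_eqI[of _ _ "u / w"])
    have "meager_in X (\<Union>{U - A q, (*) w ` (U - A q)})"
      using U(2) rot_meager[OF w(1), of "U - A q"] by (intro Un_meager) (auto intro: sub_meager)
    \<comment> \<open>A point of \<open>V\<close> outside both exceptional sets has the form
      \<open>w * y\<close> with \<open>y\<close> and \<open>w * y\<close> in
      \<open>A q\<close>.\<close>
    then have "\<not> V \<subseteq> \<Union>{U - A q, (*) w ` (U - A q)}"
      using not_meager[OF V] \<open>u \<in> V\<close> sub_meager by blast
    then obtain y where y: "y \<in> A q" "w * y \<in> A q"
      by (auto simp: V_def)
    then have "dist (F (w * y)) (F y) < e"
      using dist_triangle_half_r[of q "F (w * y)" e "F y"] by (simp add: A_def)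
    then show ?thesis
      using y by (intro bexI[of _ "w * y"] bexI[of _ y]) (auto simp: A_def)
  qed
  then show ?thesis using d by blast
qed

text \<open>The law of \<open>cis\<close> at a uniform point of the unit interval is one of the
  probability measures that universal measurability tests. An arc is enough for Steinhaus's
  argument, and on an interval of length 1 the uniform law is Lebesgue measure without a scaling
  factor.\<close>

lemma universally_measurable_circle_imp_measurable_cis:
  fixes F :: "complex \<Rightarrow> 'a::topological_space"
  assumes F: "universally_measurable_on (sphere 0 1) F"
  shows "(\<lambda>t. F (cis t)) \<in> borel_measurable (lebesgue_on {0..1})"
proof -
  define N where "N = uniform_measure lborel {0..1::real}"
  define M where "M = distr N (restrict_space borel (sphere 0 1)) cis"
  interpret N: prob_space N
    unfolding N_def by (intro prob_space_uniform_measure) auto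
  have cis: "cis \<in> N \<rightarrow>\<^sub>M restrict_space borel (sphere 0 1)"
  proof (rule measurable_restrict_space2)
    have "cis \<in> borel_measurable borel"
      by (intro borel_measurable_continuous_onI continuous_intros)
    then show "cis \<in> borel_measurable N"
      by (simp add: N_def measurable_def)
  qed simp
  have "prob_space M" unfolding M_def using cis by (rule N.prob_space_distr)
  moreover have "sets M = sets (restrict_space borel (sphere 0 1))" by (simp add: M_def)
  ultimately have FM: "F \<in> borel_measurable (completion M)"
    using F by (simp add: universally_measurable_on_def)
  have space_M: "space M = sphere 0 1" by (simp add: M_def space_restrict_space)
  show ?thesis
  proof (rule borel_measurableI)
    fix V :: "'a set" assume "open V"
    then have "F -` V \<inter> sphere 0 1 \<in> sets (completion M)"
      using measurable_sets[OF FM, of V] by (simp add: space_M)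
    then obtain S Z Z' where S: "F -` V \<inter> sphere 0 1 = S \<union> Z" "Z \<subseteq> Z'" "Z' \<in> null_sets M" "S \<in> sets M"
      by (auto elim: sets_completionE)
    have vim: "cis -` B \<in> sets borel" if "B \<in> sets M" for B
      using measurable_sets[OF cis, of B] that by (simp add: M_def N_def)
    have "Z' \<in> sets M" using S by blast
    have "emeasure N (cis -` Z') = 0"
      using S(3) emeasure_distr[OF cis, of Z'] by (simp add: M_def null_sets_def N_def)
    then have "emeasure lborel ({0..1} \<inter> cis -` Z') = 0"
      using vim[OF \<open>Z' \<in> sets M\<close>] by (simp add: N_def)
    then have "{0..1} \<inter> cis -` Z' \<in> null_sets lborel"
      using vim[OF \<open>Z' \<in> sets M\<close>] by (simp add: null_sets_def)
    then have "{0..1} \<inter> cis -` Z \<in> sets lebesgue"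
      using S(2) by (intro null_sets_completion[of "{0..1} \<inter> cis -` Z'"]) auto
    moreover have "{0..1} \<inter> cis -` S \<in> sets lebesgue"
      using vim[OF S(4)] by auto
    moreover have "F (cis t) \<in> V \<longleftrightarrow> cis t \<in> S \<or> cis t \<in> Z" for t
      using S(1) by (metis IntD1 IntI Un_iff mem_sphere_0 norm_cis vimage_eq)
    then have "(\<lambda>t. F (cis t)) -` V \<inter> {0..1} = ({0..1} \<inter> cis -` S) \<union> ({0..1} \<inter> cis -` Z)"
      by blast
    ultimately show "(\<lambda>t. F (cis t)) -` V \<inter> space (lebesgue_on {0..1}) \<in> sets (lebesgue_on {0..1})"
      by (auto simp: sets_restrict_space_iff)
  qed
qed

lemma circle_measurable_imp_near:
  fixes K :: "complex \<Rightarrow> complex"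
  assumes K: "baire_measurable_on (sphere 0 1) K \<or> universally_measurable_on (sphere 0 1) K"
    and e: "0 < e"
  shows "\<exists>d>0. \<forall>t. \<bar>t\<bar> < d \<longrightarrow> (\<exists>y. cmod y = 1 \<and> dist (K (cis t * y)) (K y) < e)"
  using K
proof
  assume "baire_measurable_on (sphere 0 1) K"
  from baire_measurable_circle_imp_quotients_cover[OF this e] obtain d where d: "d > 0" and
    near: "\<forall>w. cmod w = 1 \<and> dist w 1 < d \<longrightarrow>
      (\<exists>x\<in>sphere 0 1. \<exists>y\<in>sphere 0 1. x = w * y \<and> dist (K x) (K y) < e)"
    by (elim exE conjE)
  have "continuous_on UNIV cis" by (intro continuous_intros)
  then have "isCont cis 0" by (simp add: continuous_on_eq_continuous_at)
  then obtain s where s: "s > 0" "\<And>t. dist t 0 < s \<Longrightarrow> dist (cis t) (cis 0) < d"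
    using d unfolding continuous_at_eps_delta by metis
  have "\<exists>y. cmod y = 1 \<and> dist (K (cis t * y)) (K y) < e" if t: "\<bar>t\<bar> < s" for t
  proof -
    have "dist (cis t) 1 < d" using s(2)[of t] t by simp
    then obtain x y where "y \<in> sphere 0 1" "x = cis t * y" "dist (K x) (K y) < e"
      using near[rule_format, of "cis t"] by auto
    then show ?thesis by (intro exI[of _ y]) simp
  qed
  then show ?thesis using s(1) by blast
next
  assume "universally_measurable_on (sphere 0 1) K"
  then have "(\<lambda>t. K (cis t)) \<in> borel_measurable (lebesgue_on {0..1})"
    by (rule universally_measurable_circle_imp_measurable_cis)
  from measurable_imp_differences_cover[OF this zero_less_one e] obtain d where d: "d > 0" and
    near: "\<forall>t. \<bar>t\<bar> < d \<longrightarrow> (\<exists>x\<in>{0..1}. \<exists>y\<in>{0..1}. x - y = t \<and> dist (K (cis x)) (K (cis y)) < e)"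
    by (elim exE conjE)
  have "\<exists>y. cmod y = 1 \<and> dist (K (cis t * y)) (K y) < e" if t: "\<bar>t\<bar> < d" for t
  proof -
    obtain x y where "x - y = t" "dist (K (cis x)) (K (cis y)) < e" using near t by blast
    moreover from this(1) have "x = t + y" by simp
    then have "cis x = cis t * cis y" by (simp add: cis_mult)
    ultimately show ?thesis by (intro exI[of _ "cis y"]) simp
  qed
  then show ?thesis using d by blast
qed

section \<open>Characters of the circle and of the positive reals\<close>

text \<open>Distance below 1 from the point 1 keeps \<open>F (cis t)\<close> in the right
  half-plane. There arguments are below \<open>pi / 2\<close> in absolute value, so the sum of two
  of them stays in the principal range and \<open>Arg\<close> is additive without correction by a
  multiple of \<open>2 * pi\<close>.\<close>

lemma circle_character:
  fixes F :: "complex \<Rightarrow> complex"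
  assumes mult: "\<And>z w. cmod z = 1 \<Longrightarrow> cmod w = 1 \<Longrightarrow> F (z * w) = F z * F w"
    and norm: "\<And>z. cmod z = 1 \<Longrightarrow> cmod (F z) = 1"
    and d: "0 < d" and near: "\<And>t. \<bar>t\<bar> < d \<Longrightarrow> dist (F (cis t)) 1 < 1"
  shows "\<exists>\<beta>::int. \<forall>t. F (cis t) = cis (of_int \<beta> * t)"
proof -
  define g where "g t = Arg (F (cis t))" for t
  have cis_g: "F (cis t) = cis (g t)" for t
    using norm[of "cis t"] rcis_cmod_Arg[of "F (cis t)"] by (simp add: g_def rcis_def)
  have g_bound: "\<bar>g t\<bar> < pi / 2" if t: "\<bar>t\<bar> < d" for t
  proof -
    have "\<bar>Re (F (cis t) - 1)\<bar> < 1"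
      using near[OF t] abs_Re_le_cmod[of "F (cis t) - 1"] by (simp add: dist_norm)
    then have "0 < Re (F (cis t))" by (simp add: abs_less_iff)
    then show ?thesis unfolding g_def Arg_Re_pos by simp
  qed
  have g_add: "g (s + t) = g s + g t" if "\<bar>s\<bar> < d" "\<bar>t\<bar> < d" for s t
  proof -
    have "F (cis (s + t)) = cis (g s + g t)"
      using mult[of "cis s" "cis t"] by (simp add: cis_mult cis_g)
    then show ?thesis
      using g_bound[OF that(1)] g_bound[OF that(2)] unfolding g_def[of "s + t"]
      by (simp only:) (rule Arg_cis, simp add: abs_less_iff, linarith)
  qed
  obtain c where c: "\<And>t. \<bar>t\<bar> < d \<Longrightarrow> g t = c * t"
    using locally_additive_bounded_imp_linear[OF d, of g "pi / 2"] g_add g_bound less_imp_le by metis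
  have "F 1 * F 1 = F 1" "F 1 \<noteq> 0"
    using mult[of 1 1] norm[of 1] by auto
  then have F1: "F 1 = 1" by simp
  have F_power: "F (w ^ n) = F w ^ n" if "cmod w = 1" for w n
    using that by (induction n) (simp_all add: F1 mult norm_power)
  \<comment> \<open>Every angle is \<open>n\<close> times a small one, where linearity is already
    known.\<close>
  have F_cis: "F (cis t) = cis (c * t)" for t
  proof -
    obtain n where n: "\<bar>t\<bar> / d < real n" using reals_Archimedean2 by blast
    moreover have "0 \<le> \<bar>t\<bar> / d" using d by simp
    ultimately have n0: "0 < real n" by linarith
    then have "\<bar>t / real n\<bar> < d" using n d by (simp add: field_simps abs_mult)
    then have "F (cis (t / real n)) = cis (c * (t / real n))" using cis_g c by simp
    moreover have "cis t = cis (t / real n) ^ n" using n0 by (simp add: Complex.DeMoivre)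
    ultimately have "F (cis t) = cis (c * (t / real n)) ^ n" by (simp add: F_power)
    also have "\<dots> = cis (c * t)" using n0 by (simp add: Complex.DeMoivre)
    finally show ?thesis .
  qed
  \<comment> \<open>A full turn leads back to 1, which makes the slope an integer.\<close>
  have "cis (c * (2 * pi)) = 1"
    using F_cis[of "2 * pi"] F1 by simp
  then have "exp (\<i> * of_real (c * (2 * pi))) = 1"
    by (simp only: cis_conv_exp)
  then obtain \<beta> :: int where "c * (2 * pi) = of_int (2 * \<beta>) * pi"
    unfolding exp_eq_1 by auto
  then have "c = of_int \<beta>" by simp
  then show ?thesis using F_cis by blast
qed

text \<open>Lebesgue measurability does not in general survive composition with a continuous map.
  Here the preimage under \<open>exp\<close> is an image under \<open>ln\<close>, and differentiable
  maps send Lebesgue sets to Lebesgue sets; cutting down to \<open>{exp a..exp b}\<close> keeps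
  \<open>ln\<close> away from 0.\<close>

lemma measurable_compose_exp:
  fixes f :: "real \<Rightarrow> 'a::topological_space"
  assumes f: "f \<in> borel_measurable (lebesgue_on J)"
    and J: "J \<in> sets lebesgue" and sub: "\<And>t. a \<le> t \<Longrightarrow> t \<le> b \<Longrightarrow> exp t \<in> J"
  shows "(\<lambda>t. f (exp t)) \<in> borel_measurable (lebesgue_on {a..b})"
proof (rule borel_measurableI)
  fix V :: "'a set" assume "open V"
  then have "f -` V \<inter> J \<in> sets lebesgue"
    using measurable_sets[OF f, of V] J by (simp add: sets_restrict_space_iff)
  then have X: "f -` V \<inter> J \<inter> {exp a..exp b} \<in> sets lebesgue" by auto
  have "ln ` (f -` V \<inter> J \<inter> {exp a..exp b}) \<in> sets lebesgue"
  proof (rule differentiable_image_in_sets_lebesgue[OF X])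
    have "x > 0" if "x \<in> {exp a..exp b}" for x :: real
      using that less_le_trans[OF exp_gt_zero[of a], of x] by simp
    then have "ln differentiable (at x within f -` V \<inter> J \<inter> {exp a..exp b})"
      if "x \<in> {exp a..exp b}" for x :: real
      using that by (intro differentiableI derivative_eq_intros) auto
    then show "ln differentiable_on (f -` V \<inter> J \<inter> {exp a..exp b})"
      by (simp add: differentiable_on_def)
  qed simp
  moreover have "ln ` (f -` V \<inter> J \<inter> {exp a..exp b}) = (\<lambda>t. f (exp t)) -` V \<inter> {a..b}" (is "?L = ?R")
  proof
    show "?R \<subseteq> ?L"
    proof
      fix t assume "t \<in> ?R"
      then show "t \<in> ?L" using sub[of t] by (intro image_eqI[of _ _ "exp t"]) auto
    qed
    show "?L \<subseteq> ?R"
    proof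
      fix t assume "t \<in> ?L"
      then obtain x where x: "t = ln x" "f x \<in> V" "exp a \<le> x" "x \<le> exp b" by auto
      have "x > 0" using x(3) less_le_trans[OF exp_gt_zero] by blast
      then have "exp t = x" by (simp add: x(1))
      then have "exp a \<le> exp t" "exp t \<le> exp b" using x(3,4) by simp_all
      then have "a \<le> t" "t \<le> b" unfolding exp_le_cancel_iff .
      then show "t \<in> ?R" using x(2) \<open>exp t = x\<close> by simp
    qed
  qed
  ultimately show "(\<lambda>t. f (exp t)) -` V \<inter> space (lebesgue_on {a..b}) \<in> sets (lebesgue_on {a..b})"
    by (auto simp: sets_restrict_space_iff)
qed

lemma multiplicative_imp_powr:
  fixes f :: "real \<Rightarrow> real"
  assumes pos: "\<And>x. x \<in> P \<Longrightarrow> 0 < x"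
    and down: "\<And>x y. y \<in> P \<Longrightarrow> 0 < x \<Longrightarrow> x \<le> y \<Longrightarrow> x \<in> P"
    and b: "b \<in> P" "1 < b"
    and fpos: "\<And>x. x \<in> P \<Longrightarrow> 0 < f x"
    and mult: "\<And>x y. x \<in> P \<Longrightarrow> y \<in> P \<Longrightarrow> x * y \<in> P \<Longrightarrow> f (x * y) = f x * f y"
    and J: "is_interval J" "1 \<in> interior J"
    and meas: "f \<in> borel_measurable (lebesgue_on J)"
  shows "\<exists>\<alpha>. \<forall>x\<in>P. f x = x powr \<alpha>"
proof -
  obtain e where e: "e > 0" "cball 1 e \<subseteq> J"
    using J(2) mem_interior_cball by blast
  \<comment> \<open>\<open>b\<close> keeps \<open>c\<close> in \<open>P\<close>, and
    \<open>1 + e\<close> keeps all of \<open>{1 / c..c}\<close> in \<open>J\<close>: at the lower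
    end this needs \<open>1 / c \<ge> 2 - c\<close>, that is,
    \<open>(c - 1)^2 \<ge> 0\<close>.\<close>
  define c where "c = min b (1 + e)"
  have c: "1 < c" "c \<le> b" "c \<le> 1 + e" using b e by (auto simp: c_def)
  define \<eta> where "\<eta> = ln c"
  have \<eta>: "0 < \<eta>" "exp \<eta> = c" using c by (auto simp: \<eta>_def)
  have P_exp: "exp t \<in> P" if "t \<le> \<eta>" for t
  proof (rule down[OF b(1)])
    have "exp t \<le> exp \<eta>" using that by simp
    then show "exp t \<le> b" using c(2) \<eta>(2) by simp
  qed simp
  have J_exp: "exp t \<in> J" if "- \<eta> \<le> t" "t \<le> \<eta>" for t
  proof -
    have "exp t \<le> c" using that(2) \<eta>(2) by (metis exp_le_cancel_iff)
    have "exp (- \<eta>) \<le> exp t" using that(1) by simp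
    then have "1 / c \<le> exp t" using \<eta>(2) by (simp add: exp_minus inverse_eq_divide)
    moreover have "(2 - c) * c \<le> 1"
      using zero_le_power2[of "c - 1"] by (simp add: power2_eq_square algebra_simps)
    then have "2 - c \<le> 1 / c" using c by (simp add: field_simps)
    ultimately have "\<bar>exp t - 1\<bar> \<le> e" using \<open>exp t \<le> c\<close> c(3) by linarith
    then show ?thesis using e(2) by (auto simp: dist_real_def)
  qed
  define g where "g t = ln (f (exp t))" for t
  have g_add: "g (s + t) = g s + g t" if "s \<le> \<eta>" "t \<le> \<eta>" "s + t \<le> \<eta>" for s t
  proof -
    have "f (exp (s + t)) = f (exp s) * f (exp t)"
      using mult[of "exp s" "exp t"] P_exp[OF that(1)] P_exp[OF that(2)] P_exp[OF that(3)]
      by (simp add: exp_add)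
    then show ?thesis
      using fpos[OF P_exp[OF that(1)]] fpos[OF P_exp[OF that(2)]] by (simp add: g_def ln_mult)
  qed
  have "J \<in> sets lebesgue" using real_interval_borel_measurable[OF J(1)] by simp
  then have "(\<lambda>t. f (exp t)) \<in> borel_measurable (lebesgue_on {-\<eta>..\<eta>})"
    by (rule measurable_compose_exp[OF meas]) (rule J_exp)
  then have "g \<in> borel_measurable (lebesgue_on {-\<eta>..\<eta>})"
    unfolding g_def by measurable
  from measurable_imp_differences_cover[OF this, of 1] \<eta>(1) obtain d where d: "d > 0" and
    near: "\<And>t. \<bar>t\<bar> < d \<Longrightarrow> \<exists>x\<in>{-\<eta>..\<eta>}. \<exists>y\<in>{-\<eta>..\<eta>}. x - y = t \<and> dist (g x) (g y) < 1"
    by auto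
  define d' where "d' = min d \<eta>"
  have d': "0 < d'" "d' \<le> d" "d' \<le> \<eta>" using d \<eta> by (auto simp: d'_def)
  \<comment> \<open>Additivity turns the closeness of the values at \<open>x\<close> and
    \<open>y\<close> into a bound on the value at \<open>x - y\<close> alone.\<close>
  have bdd: "\<bar>g t\<bar> \<le> 1" if "\<bar>t\<bar> < d'" for t
  proof -
    obtain x y where xy: "x \<in> {-\<eta>..\<eta>}" "y \<in> {-\<eta>..\<eta>}" "x - y = t" "dist (g x) (g y) < 1"
      using near[of t] \<open>\<bar>t\<bar> < d'\<close> d' by auto
    then have "g x = g t + g y" using g_add[of t y] \<open>\<bar>t\<bar> < d'\<close> d' by auto
    then show ?thesis using xy(4) by (simp add: dist_real_def)
  qed
  have add': "g (s + t) = g s + g t" if "\<bar>s\<bar> < d'" "\<bar>t\<bar> < d'" "\<bar>s + t\<bar> < d'" for s t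
    using that d' by (intro g_add) auto
  obtain \<alpha> where \<alpha>: "\<And>t. \<bar>t\<bar> < d' \<Longrightarrow> g t = \<alpha> * t"
    using locally_additive_bounded_imp_linear[OF d'(1) add' bdd] by blast
  have P1: "1 \<in> P" using down[OF b(1), of 1] b(2) by simp
  have "f 1 * f 1 = f 1" "f 1 \<noteq> 0" using mult[of 1 1] P1 fpos[OF P1] by auto
  then have f1: "f 1 = 1" by simp
  \<comment> \<open>\<open>P\<close> need not be closed under products, so the intermediate powers
    must be located: they lie below 1 or below the last power.\<close>
  have f_power: "f (y ^ k) = f y ^ k" if y: "y \<in> P" "y ^ n \<in> P" and k: "k \<le> n" for y n k
  proof -
    have P_power: "y ^ k \<in> P" if "k \<le> n" for k
    proof (cases "y \<le> 1")
      case True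
      then show ?thesis using down[OF P1] pos[OF y(1)] power_le_one[of y k] by simp
    next
      case False
      then show ?thesis using down[OF y(2)] pos[OF y(1)] power_increasing[OF that, of y] by simp
    qed
    show ?thesis using k
    proof (induction k)
      case (Suc k)
      then show ?case using mult[OF y(1) P_power[of k]] P_power[of "Suc k"] by simp
    qed (simp add: f1)
  qed
  have "f x = x powr \<alpha>" if x: "x \<in> P" for x
  proof -
    define t where "t = ln x"
    have xt: "x = exp t" using pos[OF x] by (simp add: t_def)
    obtain n where n: "\<bar>t\<bar> / d' < real n" using reals_Archimedean2 by blast
    moreover have "0 \<le> \<bar>t\<bar> / d'" using d' by simp
    ultimately have n0: "0 < real n" by linarith
    then have small: "\<bar>t / real n\<bar> < d'" using n d' by (simp add: field_simps abs_mult)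
    have eP: "exp (t / real n) \<in> P" using small d' abs_ge_self[of "t / real n"] by (intro P_exp) linarith
    have "exp (t / real n) ^ n = x"
      using n0 by (simp add: xt flip: exp_of_nat_mult)
    then have "f x = f (exp (t / real n)) ^ n"
      using f_power[OF eP, of n n] x by simp
    also have "f (exp (t / real n)) = exp (\<alpha> * (t / real n))"
      using \<alpha>[OF small] exp_ln[OF fpos[OF eP]] by (simp add: g_def)
    also have "\<dots> ^ n = exp (\<alpha> * t)"
      using n0 by (simp flip: exp_of_nat_mult)
    finally show ?thesis using pos[OF x] by (simp add: powr_def t_def)
  qed
  then show ?thesis by blast
qed

text \<open>If \<open>f\<close> vanished at \<open>x\<close>, it would vanish at the iterated geometric means of \<open>x\<close> and
  \<open>x0\<close>, which tend to \<open>x0\<close>, and \<open>x0\<close> is the geometric mean of such a point and its mirror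
  image \<open>x0\<^sup>2 / y\<close>.\<close>

lemma geometric_mean_preserving_nonzero:
  fixes f :: "real \<Rightarrow> real"
  assumes pos: "\<And>x. x \<in> P \<Longrightarrow> 0 < x"
    and down: "\<And>x y. y \<in> P \<Longrightarrow> 0 < x \<Longrightarrow> x \<le> y \<Longrightarrow> x \<in> P"
    and jensen: "\<And>x y. x \<in> P \<Longrightarrow> y \<in> P \<Longrightarrow> (f (sqrt (x * y)))\<^sup>2 = f x * f y"
    and x0: "x0 \<in> P" "f x0 \<noteq> 0" and b: "b \<in> P" "x0 < b" and x: "x \<in> P"
  shows "f x \<noteq> 0"
proof
  assume fx: "f x = 0"
  have px: "0 < x0" "0 < x" using pos x0 x by auto
  define y where "y k = x0 * (x / x0) powr (1 / 2 ^ k)" for k :: nat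
  have y_pos: "0 < y k" for k using px by (simp add: y_def)
  have y_Suc: "y (Suc k) = sqrt (y k * x0)" for k
  proof -
    have "(y (Suc k))\<^sup>2 = x0\<^sup>2 * ((x / x0) powr (1 / 2 ^ Suc k))\<^sup>2"
      by (simp add: y_def power_mult_distrib)
    also have "((x / x0) powr (1 / 2 ^ Suc k))\<^sup>2 = (x / x0) powr (1 / 2 ^ k)"
      using px by (simp add: power2_eq_square flip: powr_add)
    also have "x0\<^sup>2 * \<dots> = y k * x0" by (simp add: y_def power2_eq_square)
    finally show ?thesis using y_pos[of "Suc k"] by (simp add: real_sqrt_unique)
  qed
  have yP: "y k \<in> P" for k
  proof (cases "x \<le> x0")
    case True
    have "(x / x0) powr (1 / 2 ^ k) \<le> 1" using True px by (intro powr_le1) auto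
    then have "y k \<le> x0" using px by (simp add: y_def)
    then show ?thesis using down[OF x0(1)] y_pos by blast
  next
    case False
    have "(x / x0) powr (1 / 2 ^ k) \<le> (x / x0) powr 1" using False px by (intro powr_mono) auto
    then have "y k \<le> x" using px by (simp add: y_def field_simps)
    then show ?thesis using down[OF x] y_pos by blast
  qed
  have fy: "f (y k) = 0" for k
  proof (induction k)
    case 0
    show ?case using fx px by (simp add: y_def)
  next
    case (Suc k)
    then show ?case using jensen[OF yP[of k] x0(1)] by (simp add: y_Suc)
  qed
  have "(\<lambda>k. x0\<^sup>2 / y k) \<longlonglongrightarrow> x0\<^sup>2 / (x0 * (x / x0) powr 0)"
    unfolding y_def
  proof (intro tendsto_intros)
    show "(\<lambda>k. 1 / 2 ^ k :: real) \<longlonglongrightarrow> 0"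
      using LIMSEQ_power_zero[of "1/2 :: real"] by (simp add: power_one_over)
  qed (use px in auto)
  then have "(\<lambda>k. x0\<^sup>2 / y k) \<longlonglongrightarrow> x0" using px by (simp add: power2_eq_square)
  \<comment> \<open>If \<open>x < x0\<close>, the mirror images exceed \<open>x0\<close>;
    \<open>b\<close> is the margin that keeps those near \<open>x0\<close> inside
    \<open>P\<close>.\<close>
  then have "\<forall>\<^sub>F k in sequentially. x0\<^sup>2 / y k < b" using b(2) by (rule order_tendstoD)
  then obtain k where k: "x0\<^sup>2 / y k < b" using eventually_happens'[OF sequentially_bot] by blast
  then have "x0\<^sup>2 / y k \<in> P" using down[OF b(1)] px y_pos[of k] by simp
  from jensen[OF yP[of k] this] have "(f (sqrt (x0\<^sup>2)))\<^sup>2 = 0"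
    using fy[of k] y_pos[of k] by simp
  then show False using x0(2) px by simp
qed

section \<open>Rank-one matrices and the functions \<open>Psi\<close>\<close>

lemma rank_outer_le_1:
  fixes A :: "'a::field^'n^'m"
  assumes "\<And>i j. A $ i $ j = u $ i * v $ j"
  shows "rank A \<le> 1"
proof -
  have "rows A \<subseteq> vec.span {v}"
  proof
    fix x assume "x \<in> rows A"
    then obtain i where "x = row i A" by (auto simp: rows_def)
    then have "x = u $ i *s v" by (simp add: assms row_def vec_eq_iff)
    then show "x \<in> vec.span {v}" by (auto simp: vec.span_singleton)
  qed
  then show ?thesis
    unfolding row_rank_def_gen using vec.dim_le_card[of "rows A" "{v}"] by simp
qed

lemma rank_le_1_imp_minors_eq:
  fixes A :: "'a::field^'n^'m"
  assumes "rank A \<le> 1"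
  shows "A $ i $ j * A $ k $ l = A $ i $ l * A $ k $ j"
proof -
  obtain B where B: "B \<subseteq> rows A" "vec.independent B" "rows A \<subseteq> vec.span B" "card B = vec.dim (rows A)"
    by (rule vec.basis_exists)
  have "finite B" using B(2) by (rule vec.finiteI_independent)
  moreover have "card B \<le> Suc 0" using B(4) assms by (simp add: row_rank_def_gen)
  \<comment> \<open>Only an inclusion, since the basis is empty when the rank is 0.\<close>
  ultimately have "\<exists>v. B \<subseteq> {v}"
    by (metis card_le_Suc0_iff_eq empty_subsetI insertCI subsetI subset_empty ex_in_conv)
  then obtain v where "B \<subseteq> {v}" by blast
  then have "rows A \<subseteq> vec.span {v}"
    using B(3) vec.span_mono by blast
  then have "\<exists>c. row i A = c *s v" for i
    unfolding vec.span_singleton rows_def by blast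
  then obtain c where "row i A = c i *s v" for i by metis
  then have "A $ i $ j = c i * v $ j" for i j
    by (metis row_def vec_lambda_eta vector_smult_component)
  then show ?thesis by (simp add: mult.commute mult.left_commute)
qed

text \<open>The quadratic form collapses to \<open>c\<close> times the squared modulus of a single
  sum \<open>s\<close>. Keeping \<open>c\<close> apart from \<open>u\<close> lets it be the constant
  \<open>K 1\<close> later without taking a square root.\<close>

lemma PSD_rank_le_1_outer:
  fixes A :: "complex^'n^'n"
  assumes "\<And>i j. A $ i $ j = of_real c * (u $ i * cnj (u $ j))" "0 \<le> c" "\<And>i j. A $ i $ j \<in> S"
  shows "A \<in> PSD_rank_le 1 S"
proof -
  have "pos_semidef A"
    unfolding pos_semidef_def
  proof
    fix x :: "complex^'n"
    define s where "s = (\<Sum>i\<in>UNIV. cnj (x $ i) * u $ i)"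
    have "(\<Sum>i\<in>UNIV. \<Sum>j\<in>UNIV. cnj (x $ i) * A $ i $ j * x $ j) = of_real c * (s * cnj s)"
    proof -
      have "s * cnj s = (\<Sum>i\<in>UNIV. \<Sum>j\<in>UNIV. cnj (x $ i) * u $ i * (x $ j * cnj (u $ j)))"
        by (simp add: s_def sum_product)
      then show ?thesis by (simp add: assms(1) sum_distrib_left mult_ac)
    qed
    also have "\<dots> = of_real (c * (cmod s)\<^sup>2)"
      unfolding of_real_mult complex_norm_square by (rule refl)
    finally show "0 \<le> (\<Sum>i\<in>UNIV. \<Sum>j\<in>UNIV. cnj (x $ i) * A $ i $ j * x $ j)"
      using assms(2) by (simp add: less_eq_complex_def)
  qed
  moreover have "rank A \<le> 1"
    by (rule rank_outer_le_1[where u = "\<chi> i. of_real c * u $ i" and v = "\<chi> j. cnj (u $ j)"])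
      (simp add: assms(1) mult_ac)
  ultimately show ?thesis
    using assms by (simp add: PSD_rank_le_def hermitian_def mult_ac)
qed

lemma PSD_diagonal_nonneg:
  fixes A :: "complex^'n^'n"
  assumes "pos_semidef A"
  shows "0 \<le> A $ k $ k"
proof -
  have "0 \<le> (\<Sum>i\<in>UNIV. \<Sum>j\<in>UNIV. cnj (axis k 1 $ i) * A $ i $ j * axis k 1 $ j)"
    using assms unfolding pos_semidef_def by blast
  also have "\<dots> = (\<Sum>i\<in>UNIV. if i = k then \<Sum>j\<in>UNIV. if j = k then A $ i $ j else 0 else 0)"
    by (intro sum.cong refl) (auto simp: axis_def if_distrib cong: if_cong)
  also have "\<dots> = A $ k $ k" by simp
  finally show ?thesis .
qed

text \<open>If a diagonal entry is nonzero, its column divided by the square root of that entry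
  serves as \<open>u\<close>, by the minors through the entry. If the diagonal vanishes, the minors
  and hermitian symmetry make every entry have squared modulus 0.\<close>

lemma PSD_rank_le_1_imp_outer:
  fixes A :: "complex^'n^'n"
  assumes "A \<in> PSD_rank_le 1 S"
  obtains u :: "complex^'n" where "\<And>i j. A $ i $ j = u $ i * cnj (u $ j)"
proof -
  have herm: "A $ i $ j = cnj (A $ j $ i)" for i j
    using assms unfolding PSD_rank_le_def hermitian_def by blast
  have minors: "A $ i $ j * A $ k $ l = A $ i $ l * A $ k $ j" for i j k l
    using assms by (intro rank_le_1_imp_minors_eq) (simp add: PSD_rank_le_def)
  have diag: "0 \<le> A $ k $ k" for k
    using assms by (intro PSD_diagonal_nonneg) (simp add: PSD_rank_le_def)
  show ?thesis
  proof (cases "\<exists>k. A $ k $ k \<noteq> 0")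
    case True
    then obtain k where k: "A $ k $ k \<noteq> 0" by blast
    define r where "r = Re (A $ k $ k)"
    have r: "A $ k $ k = of_real r" "r > 0"
      using k diag[of k] by (auto simp: r_def complex_eq_iff less_eq_complex_def)
    show ?thesis
    proof (rule that[of "\<chi> i. A $ i $ k / of_real (sqrt r)"])
      fix i j
      have "A $ i $ j * of_real r = A $ i $ k * cnj (A $ j $ k)"
        using minors[of i j k k] herm[of k j] r by simp
      moreover have "of_real (sqrt r) * of_real (sqrt r) = (of_real r :: complex)"
        using r by (simp flip: of_real_mult)
      ultimately show "A $ i $ j = (\<chi> i. A $ i $ k / of_real (sqrt r)) $ i * cnj ((\<chi> i. A $ i $ k / of_real (sqrt r)) $ j)"
        using r by (simp add: field_simps)
    qed
  next
    case False
    have "A $ i $ j = 0" for i j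
      using minors[of i j j i] False herm[of j i] by simp
    then show ?thesis by (intro that[of 0]) simp
  qed
qed

section \<open>Independence of multiplicative functions, and the maps \<open>Psi\<close>\<close>

lemma sum_fun_apply: "(\<Sum>f\<in>A. g f) z = (\<Sum>f\<in>A. g f z)" for g :: "'a \<Rightarrow> 'b \<Rightarrow> 'c::comm_monoid_add"
  by (induction A rule: infinite_finite_induct) simp_all

text \<open>Dedekind's independence of characters. Subtracting \<open>f0 w\<close> times the
  relation from its translate by \<open>w\<close> removes \<open>f0\<close> and multiplies the
  coefficient of \<open>g\<close> by \<open>g w - f0 w\<close>, which is nonzero for a suitable
  \<open>w\<close>.\<close>

lemma multiplicative_functions_independent:
  fixes S :: "'a::times set" and T :: "('a \<Rightarrow> 'b::idom) set"
  assumes "finite T"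
    and S: "\<And>z w. z \<in> S \<Longrightarrow> w \<in> S \<Longrightarrow> z * w \<in> S"
    and mult: "\<And>f z w. f \<in> T \<Longrightarrow> z \<in> S \<Longrightarrow> w \<in> S \<Longrightarrow> f (z * w) = f z * f w"
    and nonzero: "\<And>f. f \<in> T \<Longrightarrow> \<exists>z\<in>S. f z \<noteq> 0"
    and distinct: "\<And>f g. f \<in> T \<Longrightarrow> g \<in> T \<Longrightarrow> f \<noteq> g \<Longrightarrow> \<exists>z\<in>S. f z \<noteq> g z"
    and zero: "\<And>z. z \<in> S \<Longrightarrow> (\<Sum>f\<in>T. c f * f z) = 0"
    and "f \<in> T"
  shows "c f = 0"
  using assms
proof (induction T arbitrary: c f rule: finite_induct)
  case (insert f0 T)
  have c0: "c g = 0" if g: "g \<in> T" for g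
  proof -
    have "g \<noteq> f0" using g insert.hyps by blast
    then obtain w where w: "w \<in> S" "g w \<noteq> f0 w"
      using insert.prems(4)[of g f0] g by auto
    have "c g * (g w - f0 w) = 0"
    proof (rule insert.IH[where c = "\<lambda>f. c f * (f w - f0 w)" and f = g])
      fix z assume z: "z \<in> S"
      have "(\<Sum>f\<in>insert f0 T. c f * (f w - f0 w) * f z) =
          (\<Sum>f\<in>insert f0 T. c f * f (w * z)) - f0 w * (\<Sum>f\<in>insert f0 T. c f * f z)"
        unfolding sum_distrib_left sum_subtractf[symmetric]
      proof (rule sum.cong[OF refl])
        fix f assume "f \<in> insert f0 T"
        then have "f (w * z) = f w * f z" by (rule insert.prems(2)[OF _ w(1) z])
        then show "c f * (f w - f0 w) * f z = c f * f (w * z) - f0 w * (c f * f z)"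
          by (simp only:) (simp add: algebra_simps)
      qed
      also have "\<dots> = 0"
        using insert.prems(5)[OF z] insert.prems(5)[OF insert.prems(1)[OF w(1) z]] by (simp only:) simp
      finally show "(\<Sum>f\<in>T. c f * (f w - f0 w) * f z) = 0"
        using insert.hyps by simp
    next
      show "f (z * w) = f z * f w" if "f \<in> T" "z \<in> S" "w \<in> S" for f z w
        by (rule insert.prems(2)[OF insertI2[OF that(1)] that(2,3)])
    next
      show "\<exists>z\<in>S. f z \<noteq> g z" if "f \<in> T" "g \<in> T" "f \<noteq> g" for f g
        by (rule insert.prems(4)) (use that in auto)
    next
      show "\<exists>z\<in>S. f z \<noteq> 0" if "f \<in> T" for f
        by (rule insert.prems(3)) (use that in auto)
    next
      show "z * w \<in> S" if "z \<in> S" "w \<in> S" for z w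
        using that by (rule insert.prems(1))
    qed (rule g)
    then show ?thesis using w by simp
  qed
  obtain z where z: "z \<in> S" "f0 z \<noteq> 0" using insert.prems(3)[of f0] by auto
  have "(\<Sum>f\<in>insert f0 T. c f * f z) = c f0 * f0 z"
    using insert.hyps c0 by simp
  then have "c f0 = 0" using insert.prems(5)[OF z(1)] z by simp
  then show ?case using c0 insert.prems(6) by auto
qed simp

text \<open>Integer powers of \<open>sgn z\<close> hide the branch cut of \<open>Arg\<close>, so
  that products and conjugates become plain algebra.\<close>

lemma Psi_eq_sgn: "z \<noteq> 0 \<Longrightarrow> Psi \<alpha> \<beta> z = of_real (cmod z powr \<alpha>) * sgn z powi \<beta>"
  unfolding Psi_def using cis_Arg[of z] cis_power_int[of "Arg z" \<beta>]
  by (simp add: cis_conv_exp mult_ac)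

lemma Psi_0 [simp]: "Psi \<alpha> \<beta> 0 = 0"
  by (simp add: Psi_def)

lemma Psi_mult: "Psi \<alpha> \<beta> (z * w) = Psi \<alpha> \<beta> z * Psi \<alpha> \<beta> w"
  by (cases "z = 0 \<or> w = 0")
    (auto simp: Psi_eq_sgn norm_mult powr_mult sgn_mult power_int_mult_distrib)

lemma Psi_cnj: "Psi \<alpha> \<beta> (cnj z) = cnj (Psi \<alpha> \<beta> z)"
proof (cases "z = 0")
  case False
  have "sgn (cnj z) = cnj (sgn z)" by (simp add: sgn_div_norm)
  moreover have "cnj w powi \<beta> = cnj (w powi \<beta>)" for w
    by (simp add: power_int_def)
  ultimately show ?thesis using False by (simp add: Psi_eq_sgn)
qed simp

lemma Psi_cis: "Psi \<alpha> \<beta> (of_real r * cis t) = of_real (r powr \<alpha>) * cis (of_int \<beta> * t)" if "r > 0"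
proof -
  have "sgn (of_real r * cis t) = cis t" using that by (simp add: sgn_mult sgn_of_real)
  then show ?thesis using that by (subst Psi_eq_sgn) (simp_all add: norm_mult cis_power_int)
qed

lemma Psi_inject:
  assumes "0 < r" and eq: "\<And>z. cmod z < r \<Longrightarrow> Psi \<alpha> \<beta> z = Psi \<alpha>' \<beta>' z"
  shows "\<alpha> = \<alpha>' \<and> \<beta> = \<beta>'"
proof
  \<comment> \<open>Strictly below 1, because powers of 1 would not distinguish the
    exponents.\<close>
  define x where "x = min r 1 / 2"
  have x: "0 < x" "x < r" "x < 1" using assms(1) by (auto simp: x_def)
  have "x powr \<alpha> = x powr \<alpha>'"
    using eq[of "of_real x * cis 0"] x unfolding Psi_cis[OF x(1)] by simp
  then show "\<alpha> = \<alpha>'" using x by (simp add: powr_inj)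
  \<comment> \<open>So small that the two candidate angles differ by less than 1, hence by less than
    \<open>pi\<close>, where \<open>cis\<close> determines the difference.\<close>
  define t where "t = 1 / (\<bar>of_int (\<beta> - \<beta>')\<bar> + 1 :: real)"
  have t: "0 < t" by (auto simp: t_def)
  have "\<bar>of_int (\<beta> - \<beta>') * t\<bar> < 1" by (simp add: t_def abs_mult)
  then have small: "\<bar>of_int \<beta> * t - of_int \<beta>' * t\<bar> < 1" by (simp add: left_diff_distrib)
  have "cis (of_int \<beta> * t) = cis (of_int \<beta>' * t)"
    using eq[of "of_real x * cis t"] x \<open>\<alpha> = \<alpha>'\<close> unfolding Psi_cis[OF x(1)] by (simp add: norm_mult)
  then have "cis (of_int \<beta> * t - of_int \<beta>' * t) = 1" by (simp flip: cis_divide)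
  moreover have "Arg (cis (of_int \<beta> * t - of_int \<beta>' * t)) = of_int \<beta> * t - of_int \<beta>' * t"
    using small pi_gt3 by (intro Arg_cis) auto
  ultimately have "of_int \<beta> * t = of_int \<beta>' * t" using Arg_cis[of 0] by simp
  then show "\<beta> = \<beta>'" using t by simp
qed

lemma Psi_lin_independent:
  fixes r :: ereal
  assumes r: "0 < r"
  shows "lin_independent_on (disc r) ({Psi \<alpha> \<beta> | \<alpha> \<beta>. True} \<union> {\<lambda>z. 1})"
proof -
  define \<F> where "\<F> = {Psi \<alpha> \<beta> | \<alpha> \<beta>. True} \<union> {\<lambda>z. 1}"
  \<comment> \<open>A ball of radius at most 1 is closed under products, which \<open>disc r\<close>
    need not be; independence on the smaller set is enough.\<close>
  obtain e where e: "0 < e" "e \<le> 1" "ereal e \<le> r"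
  proof (cases r)
    case (real x)
    then show ?thesis using r that[of "min x 1"] by auto
  qed (use r that[of 1] in auto)
  define S where "S = ball (0::complex) e"
  have S_disc: "S \<subseteq> disc r"
  proof
    fix z assume "z \<in> S"
    then have "ereal (cmod z) < ereal e" by (simp add: S_def)
    also note e(3)
    finally show "z \<in> disc r" by (simp add: disc_def)
  qed
  have S_mult: "z * w \<in> S" if "z \<in> S" "w \<in> S" for z w
  proof -
    have "cmod w \<le> 1" using that(2) e(2) by (simp add: S_def)
    then have "cmod (z * w) \<le> cmod z"
      unfolding norm_mult by (intro mult_left_le) auto
    then show ?thesis using that(1) by (simp add: S_def)
  qed
  have mult: "f (z * w) = f z * f w" if "f \<in> \<F>" for f z w
    using that by (auto simp: \<F>_def Psi_mult)
  have half: "of_real (e/2) \<in> S" "0 \<in> S" using e by (auto simp: S_def)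
  have nonzero: "\<exists>z\<in>S. f z \<noteq> 0" if "f \<in> \<F>" for f
    using that half e by (auto simp: \<F>_def Psi_def intro!: bexI[of _ "of_real (e/2)"])
  have distinct: "\<exists>z\<in>S. f z \<noteq> g z" if fg: "f \<in> \<F>" "g \<in> \<F>" "f \<noteq> g" for f g
  proof (rule ccontr)
    assume "\<not> ?thesis"
    then have eq: "f z = g z" if "cmod z < e" for z
      using that by (auto simp: S_def)
    have "f = g"
    \<comment> \<open>The value at the origin separates the constant 1 from every
      \<open>Psi\<close>.\<close>
    proof (cases "f 0 = 0")
      case True
      with eq[of 0] e(1) fg(1,2) obtain \<alpha> \<beta> \<alpha>' \<beta>' where "f = Psi \<alpha> \<beta>" "g = Psi \<alpha>' \<beta>'"
        by (auto simp: \<F>_def)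
      with Psi_inject[OF e(1), of \<alpha> \<beta> \<alpha>' \<beta>'] eq show ?thesis by simp
    next
      case False
      with eq[of 0] e(1) fg(1,2) show ?thesis by (auto simp: \<F>_def)
    qed
    then show False using that by blast
  qed
  have inj: "inj_on (restrict0 (disc r)) \<F>"
  proof (rule inj_onI, rule ccontr)
    fix f g assume "f \<in> \<F>" "g \<in> \<F>" and eq: "restrict0 (disc r) f = restrict0 (disc r) g" and "f \<noteq> g"
    then obtain z where "z \<in> S" "f z \<noteq> g z" using distinct by blast
    then show False using fun_cong[OF eq, of z] S_disc by (auto simp: restrict0_def)
  qed
  have "cfun.independent (restrict0 (disc r) ` \<F>)"
  proof
    assume "cfun.dependent (restrict0 (disc r) ` \<F>)"
    then obtain T u where T: "finite T" "T \<subseteq> restrict0 (disc r) ` \<F>"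
      "(\<Sum>v\<in>T. (\<lambda>z. u v * v z)) = 0" "\<exists>v\<in>T. u v \<noteq> 0"
      unfolding cfun.dependent_explicit by blast
    have "u v = 0" if "v \<in> T" for v
    proof (rule multiplicative_functions_independent[of T S u v])
      have restr: "\<exists>f\<in>\<F>. v = restrict0 (disc r) f \<and> (\<forall>z\<in>S. v z = f z)" if "v \<in> T" for v
      proof -
        obtain f where "f \<in> \<F>" "v = restrict0 (disc r) f" using T(2) \<open>v \<in> T\<close> by blast
        then show ?thesis using S_disc by (intro bexI[of _ f]) (auto simp: restrict0_def)
      qed
      show "(\<Sum>f\<in>T. u f * f z) = 0" if "z \<in> S" for z
        using fun_cong[OF T(3), of z] by (simp add: sum_fun_apply)
      show "f (z * w) = f z * f w" if "f \<in> T" "z \<in> S" "w \<in> S" for f z w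
      proof -
        obtain g where g: "g \<in> \<F>" "\<forall>z\<in>S. f z = g z" using restr[OF \<open>f \<in> T\<close>] by blast
        show ?thesis
          using g(2) that(2,3) S_mult[OF that(2,3)] mult[OF g(1), of z w] by simp
      qed
      show "\<exists>z\<in>S. f z \<noteq> 0" if "f \<in> T" for f
        using restr[OF that(1)] nonzero by metis
      show "\<exists>z\<in>S. f z \<noteq> g z" if "f \<in> T" "g \<in> T" "f \<noteq> g" for f g
        using restr[OF that(1)] restr[OF that(2)] distinct that(3) by metis
    qed (use T(1) S_mult that in simp_all)
    with T(4) show False by blast
  qed
  then show ?thesis using inj by (simp add: lin_independent_on_def \<F>_def)
qed

section \<open>Entrywise preservers\<close>

lemma unit_mult_cnj:
  assumes "cmod w = 1"
  shows "w * cnj w = 1" "cnj w * w = 1"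
  using complex_norm_square[of w] assms by (simp_all add: mult.commute)

section \<open>The domain \<open>G\<close>\<close>

locale admissible =
  fixes G :: "complex set"
  assumes G: "admissible_domain G"
begin

text \<open>By closure under the modulus, this is also the set of moduli of the nonzero points of
  \<open>G\<close>.\<close>

definition P :: "real set" where
  "P = {x. 0 < x \<and> complex_of_real x \<in> G}"

lemma unit_in: "cmod z = 1 \<Longrightarrow> z \<in> G"
  using G unfolding admissible_domain_def radial_slice_def Let_def by auto

lemma cnj_in: "z \<in> G \<Longrightarrow> cnj z \<in> G"
  using G unfolding admissible_domain_def by blast

lemma cmod_in: "z \<in> G \<Longrightarrow> z \<noteq> 0 \<Longrightarrow> cmod z \<in> P"
  using G unfolding admissible_domain_def P_def by auto

lemma real_interval: "is_interval (real_slice G)"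
  using G unfolding admissible_domain_def Let_def by blast

lemma real_between:
  "complex_of_real a \<in> G \<Longrightarrow> complex_of_real b \<in> G \<Longrightarrow> a \<le> x \<Longrightarrow> x \<le> b \<Longrightarrow> complex_of_real x \<in> G"
  using real_interval unfolding is_interval_1 real_slice_def by blast

text \<open>The unit circle contributes -1 and 1, and the real slice is an interval.\<close>

lemma zero_in: "0 \<in> G"
  using real_between[of "-1" 1 0] unit_in[of 1] unit_in[of "-1"] by simp

lemma P_pos: "x \<in> P \<Longrightarrow> 0 < x"
  by (simp add: P_def)

lemma P_in: "x \<in> P \<Longrightarrow> complex_of_real x \<in> G"
  by (simp add: P_def)

lemma P_down: "y \<in> P \<Longrightarrow> 0 < x \<Longrightarrow> x \<le> y \<Longrightarrow> x \<in> P"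
  using real_between[of 0 y x] zero_in by (simp add: P_def)

lemma one_P: "1 \<in> P"
  using unit_in[of 1] by (simp add: P_def)

text \<open>A largest element of \<open>P\<close> would be an attained supremum of the real slice.
  The room gained is spent on the mirror images in
  \<open>geometric_mean_preserving_nonzero\<close>.\<close>

lemma P_larger:
  assumes "x \<in> P"
  shows "\<exists>y\<in>P. x < y"
proof (rule ccontr)
  assume no_larger: "\<not> ?thesis"
  have le: "y \<le> x" if y: "y \<in> real_slice G" for y
  proof (rule ccontr)
    assume "\<not> y \<le> x"
    then have "y \<in> P" "x < y"
      using y P_pos[OF assms] by (auto simp: P_def real_slice_def)
    then show False using no_larger by blast
  qed
  have x: "x \<in> real_slice G" using assms by (simp add: P_def real_slice_def)
  have "Sup (ereal ` real_slice G) = ereal x"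
    using x le by (intro antisym Sup_least Sup_upper) auto
  then show False
    using G x unfolding admissible_domain_def Let_def by simp
qed

lemma sqrt_mult_P: "x \<in> P \<Longrightarrow> y \<in> P \<Longrightarrow> sqrt (x * y) \<in> P"
proof -
  assume xy: "x \<in> P" "y \<in> P"
  have "x * y \<le> max x y * max x y"
    using P_pos[OF xy(1)] P_pos[OF xy(2)] by (intro mult_mono) auto
  then have "sqrt (x * y) \<le> max x y"
    using P_pos[OF xy(1)] by (intro real_le_lsqrt) (auto simp: power2_eq_square)
  moreover have "max x y \<in> P" using xy by (auto simp: max_def)
  ultimately show ?thesis using P_down P_pos[OF xy(1)] P_pos[OF xy(2)] by simp
qed

end

section \<open>Functional equations from vanishing minors\<close>

text \<open>\<open>S\<close> is the set of entries of a test vector, recorded as a whole because all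
  its products must lie in \<open>G\<close>; \<open>p\<close>, \<open>r\<close> select the rows and
  \<open>q\<close>, \<open>s\<close> the columns of one minor. In this form neither matrices nor the
  dimension appear any more.\<close>

locale rank_1_preserver = admissible +
  fixes K :: "complex \<Rightarrow> complex"
  assumes minor: "\<And>S p q r s. finite S \<Longrightarrow> card S \<le> 3 \<Longrightarrow> (\<forall>x\<in>S. \<forall>y\<in>S. x * cnj y \<in> G) \<Longrightarrow>
      {p, q, r, s} \<subseteq> S \<Longrightarrow> K (p * cnj q) * K (r * cnj s) = K (p * cnj s) * K (r * cnj q)"
    and herm: "\<And>z. z \<in> G \<Longrightarrow> K (cnj z) = cnj (K z)"
    and nonneg: "\<And>x. complex_of_real x \<in> G \<Longrightarrow> 0 \<le> x \<Longrightarrow> 0 \<le> K (complex_of_real x)"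
    and nonzero: "\<exists>z\<in>G. K z \<noteq> 0"
begin

definition k :: "real \<Rightarrow> real" where
  "k x = Re (K (complex_of_real x))"

lemma K_of_real: "complex_of_real x \<in> G \<Longrightarrow> 0 \<le> x \<Longrightarrow> K (complex_of_real x) = complex_of_real (k x)"
  using nonneg[of x] by (simp add: k_def complex_eq_iff less_eq_complex_def)

lemma k_sqrt:
  assumes "x \<in> P" "y \<in> P"
  shows "(k (sqrt (x * y)))\<^sup>2 = k x * k y"
proof -
  let ?a = "complex_of_real (sqrt x)" and ?b = "complex_of_real (sqrt y)"
  have ab: "?a * ?a = of_real x" "?b * ?b = of_real y" "?a * ?b = of_real (sqrt (x * y))"
      "?b * ?a = of_real (sqrt (x * y))"
    using P_pos[OF assms(1)] P_pos[OF assms(2)] by (simp_all add: real_sqrt_mult mult.commute flip: of_real_mult)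
  have "K (?a * cnj ?b) * K (?b * cnj ?a) = K (?a * cnj ?a) * K (?b * cnj ?b)"
    by (rule minor[of "{?a, ?b}"]) (use ab assms P_in sqrt_mult_P in \<open>auto simp: card_insert_if\<close>)
  then have "K (of_real (sqrt (x * y))) * K (of_real (sqrt (x * y))) = K (of_real x) * K (of_real y)"
    by (simp only: complex_cnj_complex_of_real ab)
  then have "complex_of_real (k (sqrt (x * y)) * k (sqrt (x * y))) = complex_of_real (k x * k y)"
    using assms P_in P_pos sqrt_mult_P[OF assms] by (simp add: K_of_real less_imp_le)
  then show ?thesis unfolding of_real_eq_iff by (simp add: power2_eq_square)
qed

text \<open>A zero entry in the vector links the origin to \<open>P\<close>: if \<open>K 0\<close>
  is nonzero, then \<open>k\<close> is constant on \<open>P\<close>.\<close>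

lemma K_0_mult: "K 0 * K 0 = K 0 * k x" if "x \<in> P"
proof -
  let ?a = "complex_of_real (sqrt x)"
  have a: "?a * ?a = of_real x" using P_pos[OF that] by (simp flip: of_real_mult)
  have "K (?a * cnj 0) * K (0 * cnj ?a) = K (?a * cnj ?a) * K (0 * cnj 0)"
    by (rule minor[of "{?a, 0}"]) (use a P_in[OF that] zero_in in \<open>auto simp: card_insert_if\<close>)
  then show ?thesis using a K_of_real[OF P_in[OF that]] P_pos[OF that] by (simp add: mult.commute)
qed

text \<open>The test matrix has diagonal \<open>cmod z\<close> and off-diagonal entries
  \<open>z\<close> and \<open>cnj z\<close>. It carries a nonzero value of \<open>K\<close> at any
  \<open>z \<noteq> 0\<close> to the positive reals.\<close>

lemma cmod_K:
  assumes "z \<in> G" "z \<noteq> 0"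
  shows "cmod (K z) = \<bar>k (cmod z)\<bar>"
proof -
  define r where "r = cmod z"
  define w where "w = sgn z"
  have r: "r \<in> P" "0 < r" using cmod_in[OF assms] assms(2) by (simp_all add: r_def)
  have norm_w: "cmod w = 1" using assms(2) by (simp add: w_def norm_sgn)
  note w = unit_mult_cnj[OF norm_w]
  have z: "z = of_real r * w" by (simp add: r_def w_def sgn_div_norm scaleR_conv_of_real assms(2))
  let ?a = "complex_of_real (sqrt r)"
  have a: "?a * ?a = of_real r" using r by (simp flip: of_real_mult)
  let ?c = "?a * w"
  have prods: "?a * cnj ?a = of_real r" "?c * cnj ?a = z" "?a * cnj ?c = cnj z" "?c * cnj ?c = of_real r"
  proof -
    have "?c * cnj ?a = (?a * ?a) * w" "?a * cnj ?c = (?a * ?a) * cnj w" "?c * cnj ?c = (?a * ?a) * (w * cnj w)"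
      by (simp_all only: complex_cnj_mult complex_cnj_complex_of_real mult_ac)
    then show "?c * cnj ?a = z" "?a * cnj ?c = cnj z" "?c * cnj ?c = of_real r"
      unfolding a w z by simp_all
  qed (simp add: a)
  have "K (?c * cnj ?a) * K (?a * cnj ?c) = K (?c * cnj ?c) * K (?a * cnj ?a)"
  proof (rule minor[of "{?a, ?c}"])
    show "\<forall>x\<in>{?a, ?c}. \<forall>y\<in>{?a, ?c}. x * cnj y \<in> G"
      unfolding ball_simps prods using P_in[OF r(1)] assms(1) cnj_in[OF assms(1)] by simp
  qed (auto simp: card_insert_if)
  then have "K z * cnj (K z) = of_real (k r) * of_real (k r)"
    unfolding prods herm[OF assms(1)] using K_of_real[OF P_in[OF r(1)]] r(2) by simp
  then have "complex_of_real ((cmod (K z))\<^sup>2) = complex_of_real ((k r)\<^sup>2)"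
    unfolding complex_norm_square by (simp add: power2_eq_square)
  then have "(cmod (K z))\<^sup>2 = (k r)\<^sup>2" unfolding of_real_eq_iff .
  then show ?thesis by (metis abs_norm_cancel r_def real_sqrt_abs)
qed

lemma k_pos: "0 < k x" if "x \<in> P"
proof -
  have "\<exists>x0\<in>P. k x0 \<noteq> 0"
  proof -
    obtain z where z: "z \<in> G" "K z \<noteq> 0" using nonzero by blast
    show ?thesis
    proof (cases "z = 0")
      case True
      then show ?thesis using z K_0_mult[OF one_P] one_P by (intro bexI[of _ 1]) auto
    next
      case False
      then show ?thesis using z cmod_K[OF z(1) False] cmod_in[OF z(1) False] by (intro bexI[of _ "cmod z"]) auto
    qed
  qed
  then obtain x0 where x0: "x0 \<in> P" "k x0 \<noteq> 0" by blast
  obtain b where b: "b \<in> P" "x0 < b" using P_larger[OF x0(1)] by blast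
  have "k x \<noteq> 0"
    by (rule geometric_mean_preserving_nonzero[OF P_pos P_down k_sqrt x0 b that])
  moreover have "0 \<le> k x"
    using nonneg[OF P_in[OF that]] P_pos[OF that] by (simp add: k_def less_eq_complex_def)
  ultimately show ?thesis by simp
qed

lemma K_1: "K 1 = of_real (k 1)" "0 < k 1"
  using K_of_real[OF P_in[OF one_P]] k_pos[OF one_P] by auto

text \<open>Both sides are the square of \<open>k (sqrt (x * y))\<close>, as \<open>x\<close>,
  \<open>y\<close> and \<open>x * y\<close>, \<open>1\<close> have the same geometric mean.\<close>

lemma k_mult: "k x * k y = k (x * y) * k 1" if "x \<in> P" "y \<in> P" "x * y \<in> P"
  using k_sqrt[OF that(1,2)] k_sqrt[OF that(3) one_P] by simp

lemma K_unit_mult: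
  assumes "cmod z = 1" "cmod w = 1"
  shows "K (z * w) * K 1 = K z * K w"
proof -
  have "K (z * cnj (cnj w)) * K (1 * cnj 1) = K (z * cnj 1) * K (1 * cnj (cnj w))"
    by (rule minor[of "{z, cnj w, 1}"])
      (use assms in \<open>auto simp: card_insert_if norm_mult intro!: unit_in\<close>)
  then show ?thesis by simp
qed

text \<open>No single vector serves all radii: one choice needs the square of \<open>r\<close> in
  \<open>G\<close>, the other its reciprocal, and each can fail on one side of 1.\<close>

lemma K_polar:
  assumes w: "cmod w = 1" and r: "0 < r" and z: "complex_of_real r * w \<in> G"
  shows "K (of_real r * w) * K 1 = of_real (k r) * K w"
proof -
  have rP: "r \<in> P" proof -
    have "w \<noteq> 0" using w by auto
    then show ?thesis using cmod_in[OF z] r w by (simp add: norm_mult)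
  qed
  note ww = unit_mult_cnj[OF w]
  have cz: "of_real r * cnj w \<in> G" using cnj_in[OF z] by simp
  have Kr: "K (of_real r) = of_real (k r)" using K_of_real P_in[OF rP] r by simp
  show ?thesis
  proof (cases "r \<le> 1")
    case True
    let ?R = "complex_of_real r"
    have "r * r \<in> P" using P_down[OF rP, of "r * r"] True r by (simp add: mult_left_le)
    then have "?R * ?R \<in> G" using P_in[of "r * r"] by simp
    have prods: "?R * cnj ?R = ?R * ?R" "?R * cnj (cnj w) = ?R * w" "?R * cnj 1 = ?R" "cnj w * cnj ?R = ?R * cnj w"
        "cnj w * cnj (cnj w) = 1" "cnj w * cnj 1 = cnj w" "1 * cnj ?R = ?R" "1 * cnj (cnj w) = w" "1 * cnj 1 = (1 :: complex)"
      using ww by (simp_all add: mult.commute)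
    have "K (?R * cnj (cnj w)) * K (1 * cnj 1) = K (?R * cnj 1) * K (1 * cnj (cnj w))"
    proof (rule minor[of "{?R, cnj w, 1}"])
      show "\<forall>x\<in>{?R, cnj w, 1}. \<forall>y\<in>{?R, cnj w, 1}. x * cnj y \<in> G"
        unfolding ball_simps prods using \<open>?R * ?R \<in> G\<close> z cz w P_in[OF rP] by (simp add: unit_in)
    qed (auto simp: card_insert_if)
    then show ?thesis using Kr by simp
  next
    case False
    \<comment> \<open>Here \<open>r\<^sup>2\<close> may lie outside \<open>G\<close>, so the vector \<open>(r, cnj w, 1)\<close> of the first case is not allowed.\<close>
    let ?a = "complex_of_real (sqrt r)" and ?b = "complex_of_real (1 / sqrt r)"
    have ab: "?a * ?a = of_real r" "?a * ?b = 1" "?b * ?b = of_real (1 / r)"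
      using r by (simp_all flip: of_real_mult)
    have rP': "1 / r \<in> P" using P_down[OF one_P, of "1 / r"] False r by simp
    let ?c = "?a * cnj w"
    have prods: "?a * cnj ?a = of_real r" "?a * cnj ?b = 1" "?b * cnj ?a = 1" "?b * cnj ?b = of_real (1 / r)"
        "?a * cnj ?c = of_real r * w" "?c * cnj ?a = of_real r * cnj w" "?b * cnj ?c = w" "?c * cnj ?b = cnj w"
        "?c * cnj ?c = of_real r"
    proof -
      show "?a * cnj ?a = of_real r" "?a * cnj ?b = 1" "?b * cnj ?a = 1" "?b * cnj ?b = of_real (1 / r)"
        using ab by (simp_all only: complex_cnj_complex_of_real mult.commute)
      have "?a * cnj ?c = (?a * ?a) * w" "?c * cnj ?a = (?a * ?a) * cnj w" "?b * cnj ?c = (?a * ?b) * w"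
        "?c * cnj ?b = (?a * ?b) * cnj w" "?c * cnj ?c = (?a * ?a) * (w * cnj w)"
        by (simp_all only: complex_cnj_mult complex_cnj_cnj complex_cnj_complex_of_real mult_ac)
      then show "?a * cnj ?c = of_real r * w" "?c * cnj ?a = of_real r * cnj w" "?b * cnj ?c = w" "?c * cnj ?b = cnj w"
        "?c * cnj ?c = of_real r"
        unfolding ab ww by simp_all
    qed
    \<comment> \<open>The scaling is balanced so that products only have modulus \<open>r\<close>, 1
      or \<open>1 / r\<close>, at the price of a factor \<open>K (1 / r)\<close>.\<close>
    have "K (?a * cnj ?c) * K (?b * cnj ?b) = K (?a * cnj ?b) * K (?b * cnj ?c)"
    proof (rule minor[of "{?a, ?b, ?c}"])
      show "\<forall>x\<in>{?a, ?b, ?c}. \<forall>y\<in>{?a, ?b, ?c}. x * cnj y \<in> G"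
        unfolding ball_simps prods
        using z cz w P_in[OF rP] P_in[OF rP'] by (simp add: unit_in)
    qed (auto simp: card_insert_if)
    then have "K (of_real r * w) * K (of_real (1 / r)) = K 1 * K w"
      unfolding prods .
    moreover have "K (of_real (1 / r)) = of_real (k (1 / r))"
      by (rule K_of_real[OF P_in[OF rP']]) (use r in simp)
    \<comment> \<open>This removes the extra factor: multiply the minor equation by
      \<open>k r\<close>.\<close>
    moreover have "complex_of_real (k r) * of_real (k (1 / r)) = K 1 * K 1"
      using k_mult[OF rP rP'] r one_P K_1 by (simp flip: of_real_mult)
    ultimately have "K 1 * (K (of_real r * w) * K 1) = K 1 * (of_real (k r) * K w)"
      by (metis mult.assoc mult.commute)
    then show ?thesis using K_1 by simp
  qed
qed

text \<open>\<open>K_0_mult\<close> settles the positive reals, and the vector with entries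
  \<open>w\<close>, 1, 0 settles the circle; polar decomposition joins them.\<close>

lemma K_const: "K z = K 1" if K0: "K 0 \<noteq> 0" and z: "z \<in> G"
proof -
  have k: "of_real (k x) = K 0" if "x \<in> P" for x
    using K_0_mult[OF that] K0 by simp
  have K01: "K 0 = K 1" using k[OF one_P] K_1 by simp
  have unit: "K w = K 1" if "cmod w = 1" for w
  proof -
    have "w * cnj w = 1" using that by (rule unit_mult_cnj)
    then have "K (w * cnj 1) * K (0 * cnj 0) = K (w * cnj 0) * K (0 * cnj 1)"
      by (intro minor[of "{w, 1, 0}"])
        (use that zero_in in \<open>auto simp: card_insert_if intro!: unit_in\<close>)
    then show ?thesis using K0 K01 by simp
  qed
  show ?thesis
  proof (cases "z = 0")
    case False
    have "z = of_real (cmod z) * sgn z" using False by (simp add: sgn_div_norm scaleR_conv_of_real)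
    moreover have "cmod (sgn z) = 1" using False by (simp add: norm_sgn)
    ultimately have "K z * K 1 = of_real (k (cmod z)) * K (sgn z)"
      using K_polar[of "sgn z" "cmod z"] z False by simp
    then show ?thesis using unit[of "sgn z"] k[OF cmod_in[OF z False]] K01 False K0 by (simp add: norm_sgn)
  qed (simp add: K01)
qed

lemma multiplicative: "multiplicative_on G (\<lambda>z. K z / K 1)"
  unfolding multiplicative_on_def
proof (intro ballI impI)
  fix z w assume zw: "z \<in> G" "w \<in> G" "z * w \<in> G"
  have K1: "K 1 \<noteq> 0" using K_1 by simp
  show "K (z * w) / K 1 = K z / K 1 * (K w / K 1)"
  proof (cases "K 0 = 0")
    case False
    then show ?thesis using K_const[OF False] zw K1 by simp
  next
    case K0: True
    show ?thesis
    proof (cases "z = 0 \<or> w = 0")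
      case True
      then show ?thesis using K0 by auto
    next
      case False
      then have nz: "z \<noteq> 0" "w \<noteq> 0" "z * w \<noteq> 0" by auto
      have polar: "K x * K 1 = of_real (k (cmod x)) * K (sgn x)" if "x \<in> G" "x \<noteq> 0" for x
      proof -
        have "x = of_real (cmod x) * sgn x" using that by (simp add: sgn_div_norm scaleR_conv_of_real)
        then show ?thesis
          using K_polar[of "sgn x" "cmod x"] that by (simp add: norm_sgn)
      qed
      have "k (cmod z) * k (cmod w) = k (cmod (z * w)) * k 1"
        unfolding norm_mult
        by (rule k_mult) (use cmod_in[OF zw(1) nz(1)] cmod_in[OF zw(2) nz(2)] cmod_in[OF zw(3) nz(3)] in
            \<open>simp_all add: norm_mult\<close>)
      then have kk: "complex_of_real (k (cmod z)) * of_real (k (cmod w)) = of_real (k (cmod (z * w))) * K 1"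
        unfolding K_1(1) of_real_mult[symmetric] by (rule arg_cong)
      have KK: "K (sgn (z * w)) * K 1 = K (sgn z) * K (sgn w)"
        using K_unit_mult[of "sgn z" "sgn w"] nz by (simp add: sgn_mult norm_sgn)
      \<comment> \<open>The factors \<open>K 1\<close> are carried along so that the polar formula
        applies to \<open>z\<close>, \<open>w\<close> and \<open>z * w\<close> without division, and
        cancel at the end.\<close>
      have "(K z * K 1) * (K w * K 1) =
          (complex_of_real (k (cmod z)) * of_real (k (cmod w))) * (K (sgn z) * K (sgn w))"
        unfolding polar[OF zw(1) nz(1)] polar[OF zw(2) nz(2)] by (simp add: mult_ac)
      also have "\<dots> = (of_real (k (cmod (z * w))) * K (sgn (z * w))) * (K 1 * K 1)"
        unfolding kk KK[symmetric] by (simp add: mult_ac)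
      also have "\<dots> = (K (z * w) * K 1) * (K 1 * K 1)"
        unfolding polar[OF zw(3) nz(3)] ..
      finally have "(K z * K 1) * (K w * K 1) = (K (z * w) * K 1) * (K 1 * K 1)" .
      then show ?thesis using K1 by (simp add: field_simps)
    qed
  qed
qed

end

section \<open>From matrices to test vectors and back\<close>

text \<open>A set of at most \<open>CARD('n)\<close> numbers is listed, with repetitions, as a
  vector of full length; repetitions create no new products, so the matrix still has its entries in
  \<open>G\<close>.\<close>

lemma entrywise_preserver_outer:
  fixes K :: "complex \<Rightarrow> complex"
  assumes K: "\<And>A :: complex^'n^'n. A \<in> PSD_rank_le 1 G \<Longrightarrow> map_entries K A \<in> PSD_rank_le 1 UNIV"
    and S: "finite S" "card S \<le> CARD('n)" "\<forall>x\<in>S. \<forall>y\<in>S. x * cnj y \<in> G"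
  shows "{p, q, r, s} \<subseteq> S \<Longrightarrow> K (p * cnj q) * K (r * cnj s) = K (p * cnj s) * K (r * cnj q)"
    and "{p, q} \<subseteq> S \<Longrightarrow> K (q * cnj p) = cnj (K (p * cnj q))"
    and "p \<in> S \<Longrightarrow> 0 \<le> K (p * cnj p)"
proof -
  have *: "\<exists>M :: complex^'n^'n. \<exists>u. M \<in> PSD_rank_le 1 UNIV \<and> (\<forall>i j. M $ i $ j = K (u i * cnj (u j))) \<and> range u = S"
    if S_nonempty: "S \<noteq> {}"
  proof -
    obtain h :: "complex \<Rightarrow> 'n" where h: "inj_on h S"
      using card_le_inj[OF S(1) finite[of "UNIV :: 'n set"]] S(2) by auto
    obtain p0 where p0: "p0 \<in> S" using S_nonempty by blast
    \<comment> \<open>The surplus indices repeat the element \<open>p0\<close>.\<close>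
    define u where "u i = (if i \<in> h ` S then inv_into S h i else p0)" for i
    have u_in: "u i \<in> S" for i
      using p0 by (auto simp: u_def intro: inv_into_into)
    have u_h: "u (h x) = x" if "x \<in> S" for x
      using that h by (simp add: u_def)
    have range_u: "range u = S"
    proof
      show "range u \<subseteq> S" using u_in by blast
      show "S \<subseteq> range u" using u_h by (metis rangeI subsetI)
    qed
    define A :: "complex^'n^'n" where "A = (\<chi> i j. u i * cnj (u j))"
    have "A \<in> PSD_rank_le 1 G"
      by (rule PSD_rank_le_1_outer[where c = 1 and u = "\<chi> i. u i"]) (use S(3) u_in in \<open>simp_all add: A_def\<close>)
    then have "map_entries K A \<in> PSD_rank_le 1 UNIV" by (rule K)
    moreover have "\<forall>i j. map_entries K A $ i $ j = K (u i * cnj (u j))"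
      by (simp add: map_entries_def A_def)
    ultimately show ?thesis using range_u by blast
  qed
  show "K (p * cnj q) * K (r * cnj s) = K (p * cnj s) * K (r * cnj q)" if sub: "{p, q, r, s} \<subseteq> S"
  proof -
    from sub have "S \<noteq> {}" by blast
    from *[OF this] obtain M :: "complex^'n^'n" and u where M: "M \<in> PSD_rank_le 1 UNIV"
      "\<And>i j. M $ i $ j = K (u i * cnj (u j))" "range u = S"
      by auto
    obtain i j k l where "p = u i" "q = u j" "r = u k" "s = u l"
      using sub M(3) by (metis insert_subset rangeE)
    moreover have "M $ i $ j * M $ k $ l = M $ i $ l * M $ k $ j"
      using M(1) by (intro rank_le_1_imp_minors_eq) (simp add: PSD_rank_le_def)
    ultimately show ?thesis using M(2) by simp
  qed
  show "K (q * cnj p) = cnj (K (p * cnj q))" if sub: "{p, q} \<subseteq> S"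
  proof -
    from sub have "S \<noteq> {}" by blast
    from *[OF this] obtain M :: "complex^'n^'n" and u where M: "M \<in> PSD_rank_le 1 UNIV"
      "\<And>i j. M $ i $ j = K (u i * cnj (u j))" "range u = S"
      by auto
    obtain i j where "p = u i" "q = u j"
      using sub M(3) by (metis insert_subset rangeE)
    moreover have "M $ j $ i = cnj (M $ i $ j)"
      using M(1) unfolding PSD_rank_le_def hermitian_def by blast
    ultimately show ?thesis using M(2) by simp
  qed
  show "0 \<le> K (p * cnj p)" if sub: "p \<in> S"
  proof -
    from sub have "S \<noteq> {}" by blast
    from *[OF this] obtain M :: "complex^'n^'n" and u where M: "M \<in> PSD_rank_le 1 UNIV"
      "\<And>i j. M $ i $ j = K (u i * cnj (u j))" "range u = S"
      by auto
    obtain i where "p = u i" using sub M(3) by (metis rangeE)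
    moreover have "0 \<le> M $ i $ i"
      using M(1) by (intro PSD_diagonal_nonneg) (simp add: PSD_rank_le_def)
    ultimately show ?thesis using M(2) by simp
  qed
qed

lemma entrywise_preserver_rank_1_preserver:
  assumes G: "admissible_domain G" and n: "CARD('n::finite) \<ge> 3"
    and K: "\<And>A :: complex^'n^'n. A \<in> PSD_rank_le 1 G \<Longrightarrow> map_entries K A \<in> PSD_rank_le 1 UNIV"
    and nonzero: "\<exists>z\<in>G. K z \<noteq> 0"
  shows "rank_1_preserver G K"
proof -
  interpret admissible G by unfold_locales (rule G)
  show ?thesis
  proof
    show "K (p * cnj q) * K (r * cnj s) = K (p * cnj s) * K (r * cnj q)"
      if "finite S" "card S \<le> 3" "\<forall>x\<in>S. \<forall>y\<in>S. x * cnj y \<in> G" "{p, q, r, s} \<subseteq> S" for S p q r s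
      by (rule entrywise_preserver_outer(1)[OF K that(1) _ that(3,4)]) (use that(2) n in simp_all)
    show "0 \<le> K (complex_of_real x)" if "complex_of_real x \<in> G" "0 \<le> x" for x
    proof -
      have "complex_of_real (sqrt x) * cnj (of_real (sqrt x)) = of_real x"
        using that(2) by (simp flip: of_real_mult)
      moreover have "0 \<le> K (complex_of_real (sqrt x) * cnj (of_real (sqrt x)))"
        by (rule entrywise_preserver_outer(3)[OF K, where S = "{complex_of_real (sqrt x)}"])
          (use n that calculation in simp_all)
      ultimately show ?thesis by simp
    qed
    show "K (cnj z) = cnj (K z)" if z: "z \<in> G" for z
    proof -
      \<comment> \<open>Splitting the modulus evenly puts \<open>cmod z\<close>, a point of
        \<open>G\<close>, on the diagonal and \<open>z\<close> off it.\<close>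
      define a where "a = complex_of_real (sqrt (cmod z))"
      define b where "b = a * sgn z"
      have a: "a * cnj a = of_real (cmod z)" by (simp add: a_def flip: of_real_mult)
      have "sgn z * cnj (sgn z) * of_real (cmod z) = of_real (cmod z)"
        by (cases "z = 0") (simp_all add: unit_mult_cnj norm_sgn)
      then have b: "b * cnj b = of_real (cmod z)" unfolding a[symmetric] b_def by (simp add: mult_ac)
      have ba: "b * cnj a = z"
      proof -
        have "b * cnj a = (a * cnj a) * sgn z" by (simp add: b_def mult_ac)
        also have "\<dots> = z" unfolding a by (cases "z = 0") (simp_all add: sgn_div_norm scaleR_conv_of_real)
        finally show ?thesis .
      qed
      then have ab: "a * cnj b = cnj z" by (metis complex_cnj_cnj complex_cnj_mult mult.commute)
      have "of_real (cmod z) \<in> G" using cmod_in[OF z] P_in zero_in by (cases "z = 0") auto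
      then have "\<forall>x\<in>{a, b}. \<forall>y\<in>{a, b}. x * cnj y \<in> G"
        unfolding ball_simps a b ba ab using z cnj_in[OF z] by simp
      moreover have "card {a, b} \<le> CARD('n)" using n by (auto simp: card_insert_if)
      ultimately have "K (a * cnj b) = cnj (K (b * cnj a))"
        by (intro entrywise_preserver_outer(2)[OF K, where S = "{a, b}"]) auto
      then show ?thesis unfolding ab ba .
    qed
  qed (rule nonzero)
qed

text \<open>\<open>\<psi>\<close> is evaluated at the entries of \<open>u\<close> themselves, so its
  functional equation is required on the whole plane.\<close>

lemma entrywise_outer_preserves:
  fixes A :: "complex^'n^'n"
  assumes A: "A \<in> PSD_rank_le 1 G" and c: "0 \<le> c"
    and K: "\<And>z. z \<in> G \<Longrightarrow> K z = of_real c * \<psi> z"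
    and \<psi>: "\<And>z w. \<psi> (z * cnj w) = \<psi> z * cnj (\<psi> w)"
  shows "map_entries K A \<in> PSD_rank_le 1 UNIV"
proof -
  obtain u where u: "\<And>i j. A $ i $ j = u $ i * cnj (u $ j)"
    using PSD_rank_le_1_imp_outer[OF A] by blast
  have in_G: "A $ i $ j \<in> G" for i j using A by (simp add: PSD_rank_le_def)
  have "map_entries K A $ i $ j = of_real c * (\<psi> (u $ i) * cnj (\<psi> (u $ j)))" for i j
    using K[OF in_G[of i j]] by (simp add: map_entries_def u \<psi>)
  then show ?thesis
    by (intro PSD_rank_le_1_outer[where u = "\<chi> i. \<psi> (u $ i)", OF _ c]) simp_all
qed

lemma (in admissible) multiplicative_imp_Psi:
  assumes k: "0 < k" and K1: "K 1 = complex_of_real k"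
    and mult: "multiplicative_on G (\<lambda>z. K z / K 1)"
    and equi: "conj_equivariant_on G (\<lambda>z. K z / K 1)"
    and I: "is_interval I" "1 \<in> interior I"
    and K_I: "(\<lambda>x. K (complex_of_real x)) \<in> borel_measurable (lebesgue_on I)"
    and K_circle: "baire_measurable_on (sphere 0 1) K \<or> universally_measurable_on (sphere 0 1) K"
  shows "(\<forall>z\<in>G. K z = K 1) \<or> (\<exists>\<alpha> \<beta>. \<forall>z\<in>G. K z = K 1 * Psi \<alpha> \<beta> z)"
proof -
  define F where "F z = K z / K 1" for z
  have K_F: "K z = K 1 * F z" for z using k K1 by (simp add: F_def)
  have F_mult: "F (z * w) = F z * F w" if "z \<in> G" "w \<in> G" "z * w \<in> G" for z w
    using mult that by (simp add: multiplicative_on_def F_def)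
  have F_cnj: "F (cnj z) = cnj (F z)" if "z \<in> G" for z
    using equi that by (simp add: conj_equivariant_on_def F_def)
  have F1: "F 1 = 1" using k K1 by (simp add: F_def)
  define f where "f x = Re (F (complex_of_real x))" for x
  have F_f: "F (complex_of_real x) = of_real (f x)" if "x \<in> P" for x
    using F_cnj[OF P_in[OF that]] by (simp add: f_def complex_eq_iff)
  have f_mult: "f (x * y) = f x * f y" if "x \<in> P" "y \<in> P" "x * y \<in> P" for x y
  proof -
    have "complex_of_real (f (x * y)) = of_real (f x * f y)"
      using F_mult[of "of_real x" "of_real y"] that P_in P_in[OF that(3)] F_f[OF that(3)] by (simp add: F_f)
    then show ?thesis unfolding of_real_eq_iff .
  qed
  have f1: "f 1 = 1" using F1 by (simp add: f_def)
  have sqrt_P: "sqrt x \<in> P" if "x \<in> P" for x using sqrt_mult_P[OF that one_P] by simp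
  have f_sq: "f x = (f (sqrt x))\<^sup>2" if "x \<in> P" for x
    using f_mult[OF sqrt_P sqrt_P, of x x] that P_pos[OF that] by (simp add: power2_eq_square)
  \<comment> \<open>Needed to exclude zeros of \<open>f\<close>; being a square, \<open>f x\<close>
    is then positive.\<close>
  have jensen: "(f (sqrt (x * y)))\<^sup>2 = f x * f y" if "x \<in> P" "y \<in> P" for x y
  proof -
    have "f (sqrt (x * y)) = f (sqrt x) * f (sqrt y)"
      unfolding real_sqrt_mult
      by (rule f_mult) (use sqrt_P that sqrt_mult_P[OF that] in \<open>simp_all add: real_sqrt_mult\<close>)
    then show ?thesis using f_sq[OF that(1)] f_sq[OF that(2)] by (simp add: power_mult_distrib)
  qed
  obtain b where b: "b \<in> P" "1 < b" using P_larger[OF one_P] by blast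
  have f_pos: "0 < f x" if "x \<in> P" for x
  proof -
    have f1_nonzero: "f 1 \<noteq> 0" using f1 by simp
    have "f x \<noteq> 0"
      by (rule geometric_mean_preserving_nonzero[OF P_pos P_down jensen one_P f1_nonzero b that])
    then show ?thesis using f_sq[OF that] by (metis zero_less_power2 power_zero_numeral)
  qed
  have "(\<lambda>x. Re (K (complex_of_real x)) / k) \<in> borel_measurable (lebesgue_on I)"
    using K_I by measurable
  also have "(\<lambda>x. Re (K (complex_of_real x)) / k) = f"
    by (simp add: f_def F_def K1 fun_eq_iff Re_divide_of_real)
  finally have f_meas: "f \<in> borel_measurable (lebesgue_on I)" .
  have "\<exists>\<alpha>. \<forall>x\<in>P. f x = x powr \<alpha>"
    by (rule multiplicative_imp_powr[OF P_pos P_down b f_pos f_mult I f_meas])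
  then obtain \<alpha> where \<alpha>: "\<And>x. x \<in> P \<Longrightarrow> f x = x powr \<alpha>" by blast
  have unit_mult: "F (z * w) = F z * F w" if "cmod z = 1" "cmod w = 1" for z w
    using that by (intro F_mult unit_in) (simp_all add: norm_mult)
  have unit_norm: "cmod (F z) = 1" if "cmod z = 1" for z
  proof -
    have "F z * cnj (F z) = 1"
      using unit_mult[of z "cnj z"] F_cnj[OF unit_in[OF that]] unit_mult_cnj[OF that] F1 that by simp
    then have "complex_of_real ((cmod (F z))\<^sup>2) = of_real 1"
      unfolding complex_norm_square by simp
    then have "(cmod (F z))\<^sup>2 = 1" unfolding of_real_eq_iff .
    then show ?thesis using norm_ge_zero[of "F z"] by (simp add: power2_eq_1_iff)
  qed
  \<comment> \<open>The threshold is \<open>k\<close> because \<open>K\<close> is \<open>k\<close>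
    times \<open>F\<close>: it becomes the distance 1 required by
    \<open>circle_character\<close>.\<close>
  obtain d where d: "d > 0" and
    near: "\<forall>t. \<bar>t\<bar> < d \<longrightarrow> (\<exists>y. cmod y = 1 \<and> dist (K (cis t * y)) (K y) < k)"
    using circle_measurable_imp_near[OF K_circle k] by (elim exE conjE)
  have "dist (F (cis t)) 1 < 1" if t: "\<bar>t\<bar> < d" for t
  proof -
    obtain y where y: "cmod y = 1" "dist (K (cis t * y)) (K y) < k" using near t by blast
    have "K (cis t * y) - K y = of_real k * (F (cis t) - 1) * F y"
      unfolding K_F[of "cis t * y"] K_F[of y] unit_mult[OF norm_cis y(1)] K1 by (simp add: algebra_simps)
    then have "dist (K (cis t * y)) (K y) = k * dist (F (cis t)) 1"
      using unit_norm[OF y(1)] k by (simp add: dist_norm norm_mult)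
    then show ?thesis using y(2) k by simp
  qed
  from circle_character[OF unit_mult unit_norm d this]
  obtain \<beta> :: int where \<beta>: "\<And>t. F (cis t) = cis (of_int \<beta> * t)" by blast
  show ?thesis
  \<comment> \<open>From \<open>F 0 = F 0 * F z\<close>, a nonzero value at the origin forces
    \<open>F\<close> to be 1 on \<open>G\<close>.\<close>
  proof (cases "F 0 = 0")
    case True
    have F_Psi: "F z = Psi \<alpha> \<beta> z" if z: "z \<in> G" for z
    proof (cases "z = 0")
      case False
      define r where "r = cmod z"
      define t where "t = Arg z"
      have rP: "r \<in> P" using cmod_in[OF z False] by (simp add: r_def)
      have z_eq: "z = of_real r * cis t" using rcis_cmod_Arg[of z] by (simp add: r_def t_def rcis_def)
      have "F z = F (of_real r) * F (cis t)"
        unfolding z_eq by (rule F_mult) (use P_in[OF rP] z in \<open>simp_all add: unit_in flip: z_eq\<close>)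
      also have "\<dots> = of_real (r powr \<alpha>) * cis (of_int \<beta> * t)"
        using F_f[OF rP] \<alpha>[OF rP] \<beta> by simp
      also have "\<dots> = Psi \<alpha> \<beta> z"
        unfolding z_eq by (rule Psi_cis[OF P_pos[OF rP], symmetric])
      finally show ?thesis .
    qed (simp add: True)
    have "K z = K 1 * Psi \<alpha> \<beta> z" if "z \<in> G" for z
      unfolding F_Psi[OF that, symmetric] by (rule K_F)
    then show ?thesis by blast
  next
    case False
    have "K z = K 1" if "z \<in> G" for z
      unfolding K_F[of z] using F_mult[OF zero_in that] zero_in False by simp
    then show ?thesis by blast
  qed
qed

theorem theorem8:
  fixes G :: "complex set" and K :: "complex \<Rightarrow> complex" and I :: "real set"
  assumes n: "CARD('n::finite) \<ge> 3"
    and G: "admissible_domain G"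
    and I: "is_interval I" "I \<subseteq> real_slice G" "1 \<in> interior I"
    and K_I: "(\<lambda>x. K (complex_of_real x)) \<in> borel_measurable (lebesgue_on I)"
    and K_circle: "baire_measurable_on (sphere 0 1) K \<or> universally_measurable_on (sphere 0 1) K"
  shows
    "(((\<exists>z\<in>G. K z \<noteq> 0) \<and>
       (\<forall>A :: complex^'n^'n. A \<in> PSD_rank_le 1 G \<longrightarrow> map_entries K A \<in> PSD_rank_le 1 UNIV))
      \<longleftrightarrow>
      (0 < K 1 \<and> multiplicative_on G (\<lambda>z. K z / K 1) \<and> conj_equivariant_on G (\<lambda>z. K z / K 1)))
     \<and>
     ((0 < K 1 \<and> multiplicative_on G (\<lambda>z. K z / K 1) \<and> conj_equivariant_on G (\<lambda>z. K z / K 1))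
      \<longleftrightarrow>
      (0 < K 1 \<and> ((\<forall>z\<in>G. K z = K 1) \<or> (\<exists>\<alpha> \<beta>. \<forall>z\<in>G. K z = K 1 * Psi \<alpha> \<beta> z))))
     \<and>
     (\<forall>r::ereal. 0 < r \<longrightarrow>
        lin_independent_on (disc r) ({Psi \<alpha> \<beta> | \<alpha> \<beta>. True} \<union> {\<lambda>z. 1}))"
    (is "(?preserves \<longleftrightarrow> ?mult) \<and> (?mult \<longleftrightarrow> ?explicit) \<and> _")
proof -
  interpret admissible G by unfold_locales (rule G)
  have mult: "?mult" if "?preserves"
  proof -
    interpret rank_1_preserver G K
      using that by (intro entrywise_preserver_rank_1_preserver[OF G n]) auto
    have K1: "K 1 = of_real (k 1)" "0 < k 1" using K_1 by auto
    have "conj_equivariant_on G (\<lambda>z. K z / K 1)"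
      unfolding conj_equivariant_on_def using herm K1(1) by simp
    then show ?thesis using multiplicative K1 by (simp add: less_complex_def)
  qed
  have explicit: "?explicit" if "?mult"
  proof -
    have "0 < Re (K 1)" "K 1 = of_real (Re (K 1))"
      using that by (auto simp: less_complex_def complex_eq_iff)
    from multiplicative_imp_Psi[OF this _ _ I(1,3) K_I K_circle] that show ?thesis by blast
  qed
  have converse: "?preserves" "?mult" if "?explicit"
  proof -
    define c where "c = Re (K 1)"
    have c: "0 < c" "K 1 = of_real c"
      using that by (auto simp: c_def less_complex_def complex_eq_iff)
    \<comment> \<open>Both alternatives of (3) are a positive constant times a multiplicative,
      conjugation-equivariant map of the plane.\<close>
    obtain \<psi> where \<psi>: "\<And>z. z \<in> G \<Longrightarrow> K z = of_real c * \<psi> z"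
        "\<And>z w. \<psi> (z * w) = \<psi> z * \<psi> w" "\<And>z. \<psi> (cnj z) = cnj (\<psi> z)"
    proof (cases "\<forall>z\<in>G. K z = K 1")
      case True
      then show ?thesis using c(2) by (intro that[of "\<lambda>_. 1"]) simp_all
    next
      case False
      then obtain \<alpha> \<beta> where "\<forall>z\<in>G. K z = K 1 * Psi \<alpha> \<beta> z"
        using \<open>?explicit\<close> by blast
      then show ?thesis using c(2) by (intro that[of "Psi \<alpha> \<beta>"]) (simp_all add: Psi_mult Psi_cnj)
    qed
    have "map_entries K A \<in> PSD_rank_le 1 UNIV" if "A \<in> PSD_rank_le 1 G" for A :: "complex^'n^'n"
      using entrywise_outer_preserves[OF that less_imp_le[OF c(1)] \<psi>(1)] \<psi>(2,3) by simp
    moreover have "\<exists>z\<in>G. K z \<noteq> 0" using c unit_in[of 1] by (intro bexI[of _ 1]) simp_all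
    ultimately show "?preserves" by blast
    have K_div: "K z / K 1 = \<psi> z" if "z \<in> G" for z
      using \<psi>(1)[OF that] c by simp
    then have "multiplicative_on G (\<lambda>z. K z / K 1)" "conj_equivariant_on G (\<lambda>z. K z / K 1)"
      unfolding multiplicative_on_def conj_equivariant_on_def using \<psi>(2,3) cnj_in by simp_all
    then show "?mult" using c by (simp add: less_complex_def)
  qed
  show ?thesis
  proof (intro conjI allI impI)
    show "?preserves \<longleftrightarrow> ?mult" by (rule iffI[OF mult converse(1)[OF explicit]])
    show "?mult \<longleftrightarrow> ?explicit" by (rule iffI[OF explicit converse(2)])
  qed (rule Psi_lin_independent)
qed

end
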